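(* For each $m\ge2$ and $k\in\{0,1,\dots,m-1\}$, let $$q_k(m):=\lim_{n\to\infty}\frac{[x^n]H_k(x)}{[x^n]G(x)}=\lim_{n\to\infty}\frac{\#\{\text{outputs }\ge v_k\}}{\#\{\text{all outputs}\}},$$ so that $q_{m-1}(m)=p_{m-1}(m)$ (the limiting proportion of outputs equal to the top value $1=v_{m-1}$) and $p_k(m)=q_k(m)-q_{k+1}(m)$ for $0\le k\le m-2$. Fix $t\in[0,1]$ and set $k=\lfloor t(m-1)\rfloor$. Then, as $m\to\infty$, $$q_{\lfloor t(m-1)\rfloor}(m)\longrightarrow\frac{1}{\sqrt{1+2t}}.$$ Consequently, for any fixed level index $j$ (independent of $m$) one has $p_j(m)\to0$ as $m\to\infty$; to obtain a nonzero limit one must place the cut at a macroscopic rank $k\asymp m$ (equivalently, $j/(m-1)\to t$).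
   Context: For an integer $m\ge2$ let $V_m=\{v_0<v_1<\cdots<v_{m-1}\}$ ($v_0=0$, $v_{m-1}=1$) be an $m$-element chain with Gödel implication $v_p\Rightarrow_G v_q=v_{m-1}$ if $p\le q$ and $v_p\Rightarrow_G v_q=v_q$ if $p>q$. For $n\ge1$, consider the $C_{n-1}$ full bracketings of $p_1\Rightarrow_G\cdots\Rightarrow_G p_n$ in $n$ distinct variables (full binary trees with $n$ ordered leaves), $C_k$ being the Catalan numbers. An "output" is the value in $V_m$ of a bracketed formula under a valuation $\{p_1,\dots,p_n\}\to V_m$; outputs are counted over all pairs (bracketing, valuation) for the given $n$. Let $g_n^{(j)}$ be the number of outputs equal to $v_j$ (it depends on $m$), and $g_n=\sum_{j=0}^{m-1}g_n^{(j)}=m^nC_{n-1}$ the number of all outputs. Put $G_j(x)=\sum_{n\ge1}g_n^{(j)}x^n$, $G(x)=\sum_{j=0}^{m-1}G_j(x)=\sum_{n\ge1}g_nx^n$, and let $H_k(x)=\sum_{j=k}^{m-1}G_j(x)$ be the tail sums, so that $[x^n]H_k(x)$ is the number of outputs $\ge v_k$. Finally $p_j(m):=\lim_{n\to\infty}g_n^{(j)}/g_n$ is the limiting proportion of outputs equal to $v_j$. A "cut" at rank $k$ refers to the threshold $v_k$ used in $q_k(m)$. *)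

theory Defs
  imports
    "HOL-Computational_Algebra.Formal_Power_Series"
    "HOL-Library.FuncSet"
    "HOL-Library.Landau_Symbols"
    Complex_Main
begin

text \<open>
  The element \<open>v_i\<close> of the \<open>m\<close>-element chain \<open>v_0 < \<dots> < v_{m-1}\<close> is represented by its
  rank \<open>i\<close>; thus the chain is \<open>{..<m}\<close> with bottom \<open>0\<close> and top \<open>m - 1\<close>.
\<close>

definition chain :: "nat \<Rightarrow> nat set" where
  "chain m = {..<m}"

definition godel_imp :: "nat \<Rightarrow> nat \<Rightarrow> nat \<Rightarrow> nat" where
  "godel_imp m a b = (if a \<le> b then m - 1 else b)"

datatype formula = Var nat | Imp formula formula

fun leaves :: "formula \<Rightarrow> nat list" where
  "leaves (Var i) = [i]"
| "leaves (Imp \<phi> \<psi>) = leaves \<phi> @ leaves \<psi>"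

fun eval :: "nat \<Rightarrow> (nat \<Rightarrow> nat) \<Rightarrow> formula \<Rightarrow> nat" where
  "eval m \<nu> (Var i) = \<nu> i"
| "eval m \<nu> (Imp \<phi> \<psi>) = godel_imp m (eval m \<nu> \<phi>) (eval m \<nu> \<psi>)"

text \<open>
  A full bracketing of \<open>p_1 \<Rightarrow> \<dots> \<Rightarrow> p_n\<close> is a formula whose leaves, read from left to right,
  are the variables \<open>1, \<dots>, n\<close>. There is none for \<open>n = 0\<close>.
\<close>

definition bracketings :: "nat \<Rightarrow> formula set" where
  "bracketings n = {\<phi>. leaves \<phi> = [1..<Suc n]}"

definition valuations :: "nat \<Rightarrow> nat \<Rightarrow> (nat \<Rightarrow> nat) set" where
  "valuations m n = {1..n} \<rightarrow>\<^sub>E chain m"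

text \<open>
  Outputs are counted with multiplicity, so they are indexed by pairs (bracketing, valuation).
\<close>

definition outputs :: "nat \<Rightarrow> nat \<Rightarrow> (formula \<times> (nat \<Rightarrow> nat)) set" where
  "outputs m n = bracketings n \<times> valuations m n"

definition g_level :: "nat \<Rightarrow> nat \<Rightarrow> nat \<Rightarrow> nat" where
  "g_level m j n = card {(\<phi>, \<nu>) \<in> outputs m n. eval m \<nu> \<phi> = j}"

definition g_total :: "nat \<Rightarrow> nat \<Rightarrow> nat" where
  "g_total m n = (\<Sum>j<m. g_level m j n)"

definition G_level :: "nat \<Rightarrow> nat \<Rightarrow> real fps" where
  "G_level m j = Abs_fps (\<lambda>n. if n \<ge> 1 then real (g_level m j n) else 0)"

definition G_total :: "nat \<Rightarrow> real fps" where
  "G_total m = (\<Sum>j<m. G_level m j)"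

definition H_tail :: "nat \<Rightarrow> nat \<Rightarrow> real fps" where
  "H_tail m k = (\<Sum>j\<in>{k..<m}. G_level m j)"

text \<open>
  \<open>p_lim j m\<close> and \<open>q_lim k m\<close> are \<open>p_j(m)\<close> and \<open>q_k(m)\<close>. As \<^const>\<open>lim\<close> is an unspecified value
  for a divergent sequence, the existence of these limits has to be claimed separately.
\<close>

definition p_lim :: "nat \<Rightarrow> nat \<Rightarrow> real" where
  "p_lim j m = lim (\<lambda>n. real (g_level m j n) / real (g_total m n))"

definition q_lim :: "nat \<Rightarrow> nat \<Rightarrow> real" where
  "q_lim k m = lim (\<lambda>n. fps_nth (H_tail m k) n / fps_nth (G_total m) n)"

end

(* A proper implication takes a level j < m - 1 exactly if its consequent takes level j and its
   antecedent is larger, so G_j = x + H_(j+1) G_j for j < m - 1. At the singularity x = 1/(4m) of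
   G = m x + G^2 put y_k = 1 - H_k. Then y_0 = 1/2 and y_k = y_(k+1) - x / y_(k+1).

   The coefficients of G are subexponential after rescaling: in the convolution G * G only the two ends
   matter. This turns the equation for G_j into a contraction for the ratios of coefficients, and gives
   q_(k+1) = q_k / (1 + x / y_(k+1)^2) without any singularity analysis. Consequently q_k y_k stays
   within a factor 1 + O(1/m) of 1/2, while y_k^2 = 1/4 + k / (2 m) + O(1/m). *)

theory Submission
  imports Defs "HOL-Real_Asymp.Real_Asymp"
begin

section \<open>Counting outputs\<close>

text \<open>The equation for \<open>G_j\<close> fails at the top level, which all true implications
  reach, so no recursion can start from rank \<open>m - 1\<close>. Everything is anchored at rank 0
  instead: there the tail is all of \<open>G\<close>, its value at the singularity is 1/2 and its
  ratio to \<open>G\<close> is 1. The ratios obey an equation because in a long convolution one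
  factor is short and the other carries the asymptotics. If tail \<open>k\<close> has ratio
  \<open>q\<close> and level \<open>k\<close> has ratio \<open>L\<close>, then tail
  \<open>k + 1\<close> has ratio \<open>q - L\<close>, and
  \<open>L = H_(k+1) L + G_k (q - L)\<close> with both series taken at the singularity. Inserting
  \<open>H_(k+1) = 1 - y\<close> and \<open>G_k = x / y\<close>, where \<open>y = y_(k+1)\<close>,
  gives \<open>q - L = q / (1 + x / y^2)\<close>. This only identifies the candidate. That the ratio
  converges at all is the actual difficulty, and it follows because
  \<open>H_(k+1) + G_k = H_k\<close> is at most 1/2 at the singularity, so that errors
  shrink.\<close>

fun subst_vars :: "(nat \<Rightarrow> nat) \<Rightarrow> formula \<Rightarrow> formula" where
  "subst_vars \<nu> (Var i) = Var (\<nu> i)"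
| "subst_vars \<nu> (Imp \<phi> \<psi>) = Imp (subst_vars \<nu> \<phi>) (subst_vars \<nu> \<psi>)"

text \<open>Forgets the values of a valued tree and restores the bracketing of the same shape; with
  \<open>a = 1\<close> this is the inverse of the encoding by \<open>subst_vars\<close>.\<close>

fun number_leaves :: "nat \<Rightarrow> formula \<Rightarrow> formula" where
  "number_leaves a (Var i) = Var a"
| "number_leaves a (Imp \<phi> \<psi>) =
     Imp (number_leaves a \<phi>) (number_leaves (a + length (leaves \<phi>)) \<psi>)"

text \<open>A pair (bracketing, valuation) is encoded by the bracketing with every variable replaced by its
  value, here the index of \<open>Var\<close>; the output is then the evaluation under the identity.\<close>

definition valued_trees :: "nat \<Rightarrow> nat \<Rightarrow> formula set" where
  "valued_trees m n = {\<phi>. length (leaves \<phi>) = n \<and> set (leaves \<phi>) \<subseteq> {..<m}}"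

definition count_outputs :: "nat \<Rightarrow> (nat \<Rightarrow> bool) \<Rightarrow> nat \<Rightarrow> nat" where
  "count_outputs m P n = card {\<phi> \<in> valued_trees m n. P (eval m id \<phi>)}"

lemma leaves_subst_vars: "leaves (subst_vars \<nu> \<phi>) = map \<nu> (leaves \<phi>)"
  by (induction \<phi>) auto

lemma eval_subst_vars: "eval m id (subst_vars \<nu> \<phi>) = eval m \<nu> \<phi>"
  by (induction \<phi>) auto

lemma leaves_number_leaves: "leaves (number_leaves a \<phi>) = [a..<a + length (leaves \<phi>)]"
proof (induction \<phi> arbitrary: a)
  case (Imp \<phi>1 \<phi>2)
  let ?l = "a + length (leaves \<phi>1)"
  show ?case
    using upt_add_eq_append[of a ?l "length (leaves \<phi>2)"] by (simp add: Imp.IH add.assoc)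
qed simp

lemma leaves_nonempty: "leaves \<phi> \<noteq> []"
  by (induction \<phi>) auto

text \<open>Substitution keeps the shape, so corresponding subtrees have equally many leaves and the
  common leaf list is cut at the same place on both sides.\<close>

lemma subst_vars_inject:
  assumes "subst_vars \<nu> \<phi> = subst_vars \<nu>' \<phi>'" "leaves \<phi> = leaves \<phi>'"
  shows "\<phi> = \<phi>' \<and> (\<forall>i\<in>set (leaves \<phi>). \<nu> i = \<nu>' i)"
  using assms
proof (induction \<phi> arbitrary: \<phi>')
  case (Var x)
  then show ?case by (cases \<phi>') auto
next
  case (Imp \<phi>1 \<phi>2)
  from Imp.prems(1) obtain \<psi>1 \<psi>2 where \<phi>': "\<phi>' = Imp \<psi>1 \<psi>2" by (cases \<phi>') auto
  have eq: "subst_vars \<nu> \<phi>1 = subst_vars \<nu>' \<psi>1" "subst_vars \<nu> \<phi>2 = subst_vars \<nu>' \<psi>2"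
    using Imp.prems(1) by (auto simp: \<phi>')
  have "length (leaves \<phi>1) = length (leaves \<psi>1)"
    using arg_cong[OF eq(1), of "\<lambda>f. length (leaves f)"] by (simp add: leaves_subst_vars)
  with Imp.prems(2) have "leaves \<phi>1 = leaves \<psi>1" "leaves \<phi>2 = leaves \<psi>2"
    by (auto simp: \<phi>')
  then show ?case using Imp.IH(1)[OF eq(1)] Imp.IH(2)[OF eq(2)] by (auto simp: \<phi>')
qed

lemma subst_vars_number_leaves:
  assumes "\<And>i. i < length (leaves \<phi>) \<Longrightarrow> \<nu> (a + i) = leaves \<phi> ! i"
  shows "subst_vars \<nu> (number_leaves a \<phi>) = \<phi>"
  using assms
proof (induction \<phi> arbitrary: a)
  case (Var x)
  show ?case using Var[of 0] by simp
next
  case (Imp \<phi>1 \<phi>2)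
  have "subst_vars \<nu> (number_leaves a \<phi>1) = \<phi>1"
    using Imp.prems by (intro Imp.IH(1)) (auto simp: nth_append)
  moreover have "subst_vars \<nu> (number_leaves (a + length (leaves \<phi>1)) \<phi>2) = \<phi>2"
  proof (intro Imp.IH(2))
    fix i assume "i < length (leaves \<phi>2)"
    then show "\<nu> (a + length (leaves \<phi>1) + i) = leaves \<phi>2 ! i"
      using Imp.prems[of "length (leaves \<phi>1) + i"] by (simp add: nth_append add.assoc)
  qed
  ultimately show ?case by simp
qed

text \<open>Valued trees split into subtrees without renumbering variables or restricting
  valuations, which is what makes the counts satisfy plain convolutions.\<close>

lemma card_outputs_eq:
  "card {(\<phi>, \<nu>) \<in> outputs m n. P (eval m \<nu> \<phi>)} = count_outputs m P n"
proof -
  let ?f = "\<lambda>(\<phi>, \<nu>). subst_vars \<nu> \<phi>"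
  have "bij_betw ?f {(\<phi>, \<nu>) \<in> outputs m n. P (eval m \<nu> \<phi>)}
      {\<phi> \<in> valued_trees m n. P (eval m id \<phi>)}"
  proof (rule bij_betwI')
    fix x y
    assume xy: "x \<in> {(\<phi>, \<nu>) \<in> outputs m n. P (eval m \<nu> \<phi>)}"
      "y \<in> {(\<phi>, \<nu>) \<in> outputs m n. P (eval m \<nu> \<phi>)}"
    obtain \<phi> \<nu> \<phi>' \<nu>' where [simp]: "x = (\<phi>, \<nu>)" "y = (\<phi>', \<nu>')" by (cases x, cases y)
    have l: "leaves \<phi> = [1..<Suc n]" "leaves \<phi>' = [1..<Suc n]"
      and v: "\<nu> \<in> {1..n} \<rightarrow>\<^sub>E chain m" "\<nu>' \<in> {1..n} \<rightarrow>\<^sub>E chain m"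
      using xy by (auto simp: outputs_def bracketings_def valuations_def)
    show "(?f x = ?f y) = (x = y)"
    proof
      assume "?f x = ?f y"
      then have *: "\<phi> = \<phi>'" "\<forall>i\<in>set (leaves \<phi>). \<nu> i = \<nu>' i"
        using subst_vars_inject[of \<nu> \<phi> \<nu>' \<phi>'] l by auto
      have "\<nu> = \<nu>'"
        by (rule PiE_ext[OF v]) (use * l in auto)
      with * show "x = y" by simp
    qed auto
  next
    fix x assume x: "x \<in> {(\<phi>, \<nu>) \<in> outputs m n. P (eval m \<nu> \<phi>)}"
    obtain \<phi> \<nu> where [simp]: "x = (\<phi>, \<nu>)" by (cases x)
    have l: "leaves \<phi> = [1..<Suc n]" and v: "\<nu> \<in> {1..n} \<rightarrow>\<^sub>E chain m" and P: "P (eval m \<nu> \<phi>)"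
      using x by (auto simp: outputs_def bracketings_def valuations_def)
    have "\<nu> i < m" if "i \<in> {1..n}" for i
      using v that by (auto simp: chain_def PiE_def Pi_def)
    then show "?f x \<in> {\<phi> \<in> valued_trees m n. P (eval m id \<phi>)}"
      using l P by (auto simp: valued_trees_def eval_subst_vars leaves_subst_vars)
  next
    fix \<psi> assume \<psi>: "\<psi> \<in> {\<phi> \<in> valued_trees m n. P (eval m id \<phi>)}"
    \<comment> \<open>Variables are numbered from 1 and list positions from 0, hence the shift;
      \<open>restrict\<close> makes the valuation extensional, as \<open>valuations\<close>
      demands.\<close>
    define \<nu> where "\<nu> = restrict (\<lambda>i. leaves \<psi> ! (i - 1)) {1..n}"
    let ?\<phi> = "number_leaves 1 \<psi>"
    have n: "length (leaves \<psi>) = n" using \<psi> by (simp add: valued_trees_def)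
    have eq: "subst_vars \<nu> ?\<phi> = \<psi>"
      by (rule subst_vars_number_leaves) (auto simp: \<nu>_def n)
    have "\<nu> \<in> {1..n} \<rightarrow>\<^sub>E chain m"
    proof (rule PiE_I)
      fix i assume i: "i \<in> {1..n}"
      then have "leaves \<psi> ! (i - 1) \<in> set (leaves \<psi>)" by (intro nth_mem) (auto simp: n)
      then show "\<nu> i \<in> chain m" using \<psi> i by (auto simp: valued_trees_def chain_def \<nu>_def)
    qed (auto simp: \<nu>_def)
    moreover have "leaves ?\<phi> = [1..<Suc n]" by (simp add: leaves_number_leaves n del: upt_Suc)
    moreover have "P (eval m \<nu> ?\<phi>)" using \<psi> eq eval_subst_vars[of m \<nu> ?\<phi>] by simp
    ultimately show "\<exists>x\<in>{(\<phi>, \<nu>) \<in> outputs m n. P (eval m \<nu> \<phi>)}. \<psi> = ?f x"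
      using eq by (intro bexI[of _ "(?\<phi>, \<nu>)"])
        (auto simp: outputs_def bracketings_def valuations_def simp del: upt_Suc)
  qed
  then show ?thesis unfolding count_outputs_def by (rule bij_betw_same_card)
qed

lemma finite_valued_trees: "finite (valued_trees m n)"
proof (induction n rule: less_induct)
  case (less n)
  have "valued_trees m n \<subseteq> Var ` {..<m} \<union>
      (\<Union>i\<in>{..<n}. \<Union>j\<in>{..<n}. (\<lambda>(\<phi>, \<psi>). Imp \<phi> \<psi>) ` (valued_trees m i \<times> valued_trees m j))"
    (is "_ \<subseteq> ?R")
  proof
    fix \<phi> assume \<phi>: "\<phi> \<in> valued_trees m n"
    show "\<phi> \<in> ?R"
    proof (cases \<phi>)
      case (Var x)
      then show ?thesis using \<phi> by (auto simp: valued_trees_def)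
    next
      case (Imp \<phi>1 \<phi>2)
      have "\<phi>1 \<in> valued_trees m (length (leaves \<phi>1))" "\<phi>2 \<in> valued_trees m (length (leaves \<phi>2))"
        "length (leaves \<phi>1) < n" "length (leaves \<phi>2) < n"
        using \<phi> leaves_nonempty[of \<phi>1] leaves_nonempty[of \<phi>2]
        by (auto simp: Imp valued_trees_def)
      then show ?thesis by (force simp: Imp)
    qed
  qed
  moreover have "finite ?R" using less by auto
  ultimately show ?case by (rule finite_subset)
qed

section \<open>Convolution recursions for the output counts\<close>

lemma valued_trees_0: "valued_trees m 0 = {}"
  by (auto simp: valued_trees_def leaves_nonempty)

lemma eval_less:
  assumes "\<phi> \<in> valued_trees m n"
  shows "eval m id \<phi> < m"
proof -
  have "set (leaves \<phi>) \<subseteq> {..<m} \<Longrightarrow> eval m id \<phi> < m"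
  proof (induction \<phi>)
    case (Imp \<phi>1 \<phi>2)
    then show ?case by (auto simp: godel_imp_def)
  qed simp
  with assms show ?thesis by (simp add: valued_trees_def)
qed

lemma count_outputs_0: "count_outputs m P 0 = 0"
  by (simp add: count_outputs_def valued_trees_0)

lemma count_outputs_1: "count_outputs m P 1 = card {i. i < m \<and> P i}"
proof -
  have "{\<phi> \<in> valued_trees m 1. P (eval m id \<phi>)} = Var ` {i. i < m \<and> P i}"
  proof (intro equalityI subsetI)
    fix \<phi> assume \<phi>: "\<phi> \<in> {\<phi> \<in> valued_trees m 1. P (eval m id \<phi>)}"
    show "\<phi> \<in> Var ` {i. i < m \<and> P i}"
    proof (cases \<phi>)
      case (Imp \<phi>1 \<phi>2)
      then show ?thesis using \<phi> leaves_nonempty[of \<phi>1] leaves_nonempty[of \<phi>2]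
        by (cases "leaves \<phi>1"; cases "leaves \<phi>2") (auto simp: valued_trees_def)
    qed (use \<phi> in \<open>auto simp: valued_trees_def\<close>)
  qed (auto simp: valued_trees_def)
  then show ?thesis
    unfolding count_outputs_def by (simp add: card_image inj_on_def)
qed

text \<open>If a condition on the output of an implication factors into separate conditions on
  antecedent and consequent, splitting at the root gives a Cauchy product. This serves the total
  count, where all three conditions are trivial, and a level \<open>k\<close> below the top, with
  \<open>P\<close> meaning above \<open>k\<close> and \<open>Q\<close> meaning equal to
  \<open>k\<close>. The extreme summands vanish because every tree has a leaf.\<close>

lemma count_outputs_Imp:
  assumes "n \<ge> 2"
    and PQR: "\<And>a b. a < m \<Longrightarrow> b < m \<Longrightarrow> R (godel_imp m a b) \<longleftrightarrow> P a \<and> Q b"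
  shows "count_outputs m R n = (\<Sum>i\<le>n. count_outputs m P i * count_outputs m Q (n - i))"
proof -
  let ?C = "\<lambda>P i. {\<phi> \<in> valued_trees m i. P (eval m id \<phi>)}"
  let ?I = "\<lambda>i. (\<lambda>(\<phi>, \<psi>). Imp \<phi> \<psi>) ` (?C P i \<times> ?C Q (n - i))"
  have "?C R n = (\<Union>i\<le>n. ?I i)"
  proof (intro equalityI subsetI)
    fix \<phi> assume \<phi>: "\<phi> \<in> ?C R n"
    show "\<phi> \<in> (\<Union>i\<le>n. ?I i)"
    proof (cases \<phi>)
      case (Var x)
      then show ?thesis using \<phi> \<open>n \<ge> 2\<close> by (auto simp: valued_trees_def)
    next
      case (Imp \<phi>1 \<phi>2)
      let ?i = "length (leaves \<phi>1)"
      have t: "\<phi>1 \<in> valued_trees m ?i" "\<phi>2 \<in> valued_trees m (n - ?i)" "?i \<le> n"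
        using \<phi> by (auto simp: Imp valued_trees_def)
      moreover have "P (eval m id \<phi>1)" "Q (eval m id \<phi>2)"
        using \<phi> PQR[OF eval_less[OF t(1)] eval_less[OF t(2)]] by (auto simp: Imp)
      ultimately show ?thesis by (auto simp: Imp)
    qed
  next
    fix \<phi> assume "\<phi> \<in> (\<Union>i\<le>n. ?I i)"
    then obtain i \<phi>1 \<phi>2 where *: "i \<le> n" "\<phi> = Imp \<phi>1 \<phi>2" "\<phi>1 \<in> ?C P i" "\<phi>2 \<in> ?C Q (n - i)"
      by auto
    then have t: "\<phi>1 \<in> valued_trees m i" "\<phi>2 \<in> valued_trees m (n - i)" by simp_all
    have "R (eval m id \<phi>)"
      using PQR[OF eval_less[OF t(1)] eval_less[OF t(2)]] * by simp
    then show "\<phi> \<in> ?C R n" using * by (auto simp: valued_trees_def)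
  qed
  moreover have "card (\<Union>i\<le>n. ?I i) = (\<Sum>i\<le>n. card (?I i))"
    by (rule card_UN_disjoint) (auto simp: finite_valued_trees, auto simp: valued_trees_def)
  moreover have "card (?I i) = card (?C P i) * card (?C Q (n - i))" for i
    by (subst card_image) (auto simp: inj_on_def card_cartesian_product)
  ultimately show ?thesis by (simp add: count_outputs_def)
qed

lemma count_outputs_disjoint:
  assumes "\<And>v. v < m \<Longrightarrow> R v \<longleftrightarrow> P v \<or> Q v" "\<And>v. \<not> (P v \<and> Q v)"
  shows "count_outputs m R n = count_outputs m P n + count_outputs m Q n"
proof -
  have "{\<phi> \<in> valued_trees m n. R (eval m id \<phi>)} =
      {\<phi> \<in> valued_trees m n. P (eval m id \<phi>)} \<union> {\<phi> \<in> valued_trees m n. Q (eval m id \<phi>)}"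
    using assms(1) eval_less by blast
  then show ?thesis
    unfolding count_outputs_def using assms(2)
    by (subst card_Un_disjoint[symmetric]) (auto simp: finite_valued_trees)
qed

lemma sum_g_level: "(\<Sum>j\<in>{k..<m}. g_level m j n) = count_outputs m ((\<le>) k) n"
proof -
  have g: "g_level m j n = count_outputs m (\<lambda>v. v = j) n" for j
    unfolding g_level_def by (rule card_outputs_eq)
  have "{\<phi> \<in> valued_trees m n. k \<le> eval m id \<phi>} =
      (\<Union>j\<in>{k..<m}. {\<phi> \<in> valued_trees m n. eval m id \<phi> = j})"
    using eval_less by auto
  also have "card \<dots> = (\<Sum>j\<in>{k..<m}. count_outputs m (\<lambda>v. v = j) n)"
    unfolding count_outputs_def
    by (rule card_UN_disjoint) (auto simp: finite_valued_trees)
  finally show ?thesis by (simp add: g count_outputs_def)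
qed

lemma g_total_eq: "g_total m n = count_outputs m ((\<le>) 0) n"
  unfolding g_total_def lessThan_atLeast0 by (rule sum_g_level)

lemma nth_H_tail: "fps_nth (H_tail m k) n = real (count_outputs m ((\<le>) k) n)"
proof (cases "n = 0")
  case True
  then show ?thesis
    by (simp add: H_tail_def fps_sum_nth G_level_def count_outputs_0)
next
  case False
  then have "fps_nth (H_tail m k) n = (\<Sum>j\<in>{k..<m}. real (g_level m j n))"
    by (simp add: H_tail_def fps_sum_nth G_level_def)
  then show ?thesis by (simp only: sum_g_level flip: of_nat_sum)
qed

lemma nth_G_total: "fps_nth (G_total m) n = real (count_outputs m ((\<le>) 0) n)"
  using nth_H_tail[of m 0 n] unfolding H_tail_def G_total_def lessThan_atLeast0 .

section \<open>Catalan weights and ratio limits\<close>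

text \<open>Both ends keep the fixed length \<open>K\<close> while \<open>n\<close> grows, so limits
  can be taken term by term there; the upper end is reversed for this purpose.\<close>

lemma sum_split_ends:
  fixes h :: "nat \<Rightarrow> real"
  assumes "n \<ge> 2 * K"
  shows "(\<Sum>i\<le>n. h i) = (\<Sum>i<K. h i) + (\<Sum>i<K. h (n - i)) + (\<Sum>i\<in>{K..n-K}. h i)"
proof (cases "K = 0")
  case True
  then show ?thesis by (simp add: atMost_atLeast0)
next
  case False
  have "{..n} = {..<K} \<union> ({K..n-K} \<union> (\<lambda>i. n - i) ` {..<K})"
  proof (intro equalityI subsetI)
    fix x assume x: "x \<in> {..n}"
    show "x \<in> {..<K} \<union> ({K..n-K} \<union> (\<lambda>i. n - i) ` {..<K})"
    proof (cases "x \<le> n - K")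
      case False
      then have "x = n - (n - x)" "n - x < K" using x by auto
      then show ?thesis by blast
    qed auto
  qed (use assms in auto)
  moreover have "{..<K} \<inter> ({K..n-K} \<union> (\<lambda>i. n - i) ` {..<K}) = {}"
    "{K..n-K} \<inter> (\<lambda>i. n - i) ` {..<K} = {}" using assms by auto
  moreover have "(\<Sum>i\<in>(\<lambda>i. n - i) ` {..<K}. h i) = (\<Sum>i<K. h (n - i))"
    using assms by (subst sum.reindex) (auto simp: inj_on_def)
  ultimately show ?thesis by (simp add: sum.union_disjoint)
qed

text \<open>Each application of \<open>step\<close> may move the threshold in \<open>n\<close>,
  which is harmless because a given precision needs only finitely many applications.
  \<open>max E0 1\<close> replaces \<open>E0\<close> since \<open>step\<close> is available only for
  positive bounds.\<close>

lemma tendsto_0_by_contraction: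
  fixes e :: "nat \<Rightarrow> real"
  assumes "\<forall>\<^sub>F n in sequentially. \<bar>e n\<bar> \<le> E0" "0 < c" "c < 1"
    and step: "\<And>E. E > 0 \<Longrightarrow> \<forall>\<^sub>F n in sequentially. \<bar>e n\<bar> \<le> E \<Longrightarrow> \<forall>\<^sub>F n in sequentially. \<bar>e n\<bar> \<le> c * E"
  shows "e \<longlonglongrightarrow> 0"
proof (rule tendsto_rabs_zero_cancel, rule order_tendstoI)
  fix \<epsilon> :: real assume "\<epsilon> > 0"
  have "(\<lambda>j. c ^ j * max E0 1) \<longlonglongrightarrow> 0 * max E0 1"
    using assms(2,3) by (intro tendsto_mult tendsto_const LIMSEQ_realpow_zero) auto
  then have "\<forall>\<^sub>F j in sequentially. c ^ j * max E0 1 < \<epsilon>"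
    using \<open>\<epsilon> > 0\<close> by (intro order_tendstoD) auto
  then obtain j where j: "c ^ j * max E0 1 < \<epsilon>"
    by (auto simp: eventually_at_top_linorder)
  have "\<forall>\<^sub>F n in sequentially. \<bar>e n\<bar> \<le> c ^ j * max E0 1"
  proof (induction j)
    case 0
    show ?case using assms(1) by eventually_elim simp
  next
    case (Suc j)
    have "c ^ j * max E0 1 > 0" using assms(2) by simp
    from step[OF this Suc] show ?case by (simp add: mult.assoc)
  qed
  then show "\<forall>\<^sub>F n in sequentially. \<bar>e n\<bar> < \<epsilon>"
    by eventually_elim (use j in auto)
qed (auto intro!: always_eventually intro: less_le_trans)

text \<open>The weights are \<open>C_(n-1) / 4^n\<close> with Catalan numbers \<open>C\<close>;
  their generating function is \<open>(1 - sqrt (1 - x)) / 2\<close>.\<close>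

locale catalan_weights =
  fixes w :: "nat \<Rightarrow> real"
  assumes w_0: "w 0 = 0" and w_1: "w (Suc 0) = 1/4"
    and w_conv: "n \<ge> 2 \<Longrightarrow> w n = (\<Sum>i\<le>n. w i * w (n - i))"
begin

text \<open>Differentiating \<open>W = x/4 + W^2\<close> gives \<open>W' (1 - 2 W) = 1/4\<close>.
  Another factor \<open>1 - 2 W\<close>, whose square is \<open>1 - x\<close>, makes this linear:
  \<open>(1 - x) W' = 1/4 - W/2\<close>. The recurrence is the comparison of coefficients.\<close>

lemma w_Suc:
  assumes "n \<ge> 1"
  shows "real (Suc n) * w (Suc n) = (real n - 1/2) * w n"
proof -
  define W where "W = Abs_fps w"
  have W: "W = fps_const (1/4) * fps_X + W * W"
  proof (rule fps_ext)
    fix n :: nat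
    have sq: "fps_nth (W * W) n = (\<Sum>i\<le>n. w i * w (n - i))"
      by (simp add: W_def fps_mult_nth atMost_atLeast0)
    consider "n = 0" | "n = 1" | "n \<ge> 2" by linarith
    then show "fps_nth W n = fps_nth (fps_const (1/4) * fps_X + W * W) n"
    proof cases
      case 3
      then show ?thesis using w_conv[OF 3]
        by (simp add: sq) (simp add: W_def)
    qed (simp_all add: sq, simp_all add: W_def w_0 w_1)
  qed
  have "fps_deriv W = fps_deriv (fps_const (1/4) * fps_X + W * W)" using W by simp
  then have D: "fps_deriv W = fps_const (1/4) + 2 * W * fps_deriv W"
    by (simp add: mult.assoc)
  have c: "4 * fps_const (1/4) = (1 :: real fps)"
    by (simp add: fps_numeral_fps_const)
  have 4: "4 * W = fps_X + 4 * (W * W)"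
    using arg_cong[OF W, of "\<lambda>f. 4 * f"] c by (simp add: distrib_left flip: mult.assoc)
  have "(1 - 2 * W) * (1 - 2 * W) = 1 - 4 * W + 4 * (W * W)" by (simp add: algebra_simps)
  then have sq: "(1 - 2 * W) * (1 - 2 * W) = 1 - fps_X" using 4 by simp
  have "fps_deriv W * (1 - 2 * W) = fps_const (1/4)" using D by (simp add: algebra_simps)
  then have "fps_deriv W * (1 - fps_X) = fps_const (1/4) * (1 - 2 * W)"
    by (metis sq mult.assoc)
  then have eq: "fps_deriv W - fps_deriv W * fps_X = fps_const (1/4) - fps_const (1/2) * W"
    by (simp add: algebra_simps fps_numeral_fps_const)
  have "fps_nth (fps_deriv W - fps_deriv W * fps_X) n = fps_nth (fps_const (1/4) - fps_const (1/2) * W) n"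
    by (simp only: eq)
  then show ?thesis
    using assms by (cases n) (auto simp: W_def algebra_simps)
qed

lemma w_pos: "n \<ge> 1 \<Longrightarrow> w n > 0"
proof (induction n rule: dec_induct)
  case base
  then show ?case by (simp add: w_1)
next
  case (step n)
  have "real (Suc n) * w (Suc n) > 0"
    unfolding w_Suc[OF step.hyps(1)] using step by (intro mult_pos_pos) auto
  then show ?case by (simp add: zero_less_mult_iff)
qed

lemma w_nonneg: "w n \<ge> 0"
  using w_pos[of n] by (cases "n = 0") (auto simp: w_0)

text \<open>Together with \<open>w_sums\<close> this is the subexponential behaviour: a shift by a
  fixed amount does not change the weight asymptotically. One shift is read off from
  \<open>w_Suc\<close>, and \<open>i\<close> shifts multiply.\<close>

lemma w_ratio: "(\<lambda>n. w (n - i) / w n) \<longlonglongrightarrow> 1"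
proof -
  have 1: "(\<lambda>n. w n / w (Suc n)) \<longlonglongrightarrow> 1"
  proof (rule Lim_transform_eventually)
    show "(\<lambda>n. (real n + 1) / (real n - 1/2)) \<longlonglongrightarrow> 1"
      by real_asymp
    show "\<forall>\<^sub>F n in sequentially. (real n + 1) / (real n - 1/2) = w n / w (Suc n)"
      using eventually_ge_at_top[of 1]
    proof eventually_elim
      case (elim n)
      then show ?case
        using w_Suc[OF elim] w_pos[of "Suc n"] by (simp add: field_simps)
    qed
  qed
  have "(\<lambda>n. w n / w (n + i)) \<longlonglongrightarrow> 1"
  proof (induction i)
    case 0
    have "\<forall>\<^sub>F n in sequentially. 1 = w n / w (n + 0)"
      using eventually_ge_at_top[of 1] by eventually_elim (use w_pos in force)
    then show ?case by (rule Lim_transform_eventually[OF tendsto_const])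
  next
    case (Suc i)
    have "(\<lambda>n. w n / w (n + i) * (w (n + i) / w (Suc (n + i)))) \<longlonglongrightarrow> 1 * 1"
      by (intro tendsto_mult Suc LIMSEQ_ignore_initial_segment[OF 1])
    moreover have "\<forall>\<^sub>F n in sequentially. w n / w (n + i) * (w (n + i) / w (Suc (n + i))) = w n / w (n + Suc i)"
      using eventually_ge_at_top[of 1]
    proof eventually_elim
      case (elim n)
      then show ?case using w_pos[of "n + i"] by simp
    qed
    ultimately show ?case by (simp add: Lim_transform_eventually)
  qed
  then have "(\<lambda>n. w ((n + i) - i) / w (n + i)) \<longlonglongrightarrow> 1" by simp
  then show ?thesis by (rule LIMSEQ_offset)
qed

lemma w_summable: "summable w"
proof (rule bounded_imp_summable[OF w_nonneg])
  show "(\<Sum>i\<le>n. w i) \<le> 1/2" for n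
  proof -
    \<comment> \<open>\<open>w_Suc\<close> says \<open>w n = 2 n w n - 2 (n + 1) w (n + 1)\<close>,
      so the partial sums telescope.\<close>
    have "(\<Sum>i\<le>n. w i) = 1/2 - 2 * real (Suc n) * w (Suc n)"
    proof (induction n)
      case 0
      then show ?case by (simp add: w_0 w_1)
    next
      case (Suc n)
      then show ?case using w_Suc[of "Suc n"] by (simp add: algebra_simps)
    qed
    then show ?thesis using w_nonneg[of "Suc n"] by simp
  qed
qed

text \<open>Summing the convolution equation gives \<open>s = s^2 + 1/4\<close>. Its only root is
  the double root 1/2, so no branch has to be chosen.\<close>

lemma w_sums: "w sums (1/2)"
proof -
  define s where "s = suminf w"
  have "(\<lambda>n. \<Sum>i\<le>n. w i * w (n - i)) sums (s * s)"
    unfolding s_def using w_summable w_nonneg by (intro Cauchy_product_sums) auto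
  then have "(\<lambda>n. (\<Sum>i\<le>n. w i * w (n - i)) + (if n = 1 then 1/4 else 0)) sums (s * s + 1/4)"
    by (intro sums_add sums_single)
  moreover have "(\<Sum>i\<le>n. w i * w (n - i)) + (if n = 1 then 1/4 else 0) = w n" for n
  proof -
    consider "n = 0" | "n = 1" | "n \<ge> 2" by linarith
    then show ?thesis by cases (auto simp: w_0 w_1 w_conv)
  qed
  ultimately have "w sums (s * s + 1/4)" by simp
  then have "s = s * s + 1/4" unfolding s_def by (rule sums_unique[symmetric])
  then have "(s - 1/2)\<^sup>2 = 0" by (simp add: power2_eq_square algebra_simps)
  then have "s = 1/2" by simp
  then show ?thesis using summable_sums[OF w_summable] unfolding s_def by metis
qed

text \<open>The two ends of the convolution carry asymptotically \<open>2 \<Sum>w = 1\<close> times \<open>w n\<close>, which is the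
  whole convolution; hence nothing is left for the middle.\<close>

lemma w_middle:
  assumes "\<epsilon> > 0"
  shows "\<exists>K0. \<forall>K\<ge>K0. \<forall>\<^sub>F n in sequentially. (\<Sum>i\<in>{K..n-K}. w i * w (n - i)) \<le> \<epsilon> * w n"
proof -
  have "(\<lambda>K. \<Sum>i<K. w i) \<longlonglongrightarrow> 1/2" using w_sums by (simp add: sums_def)
  then have "\<forall>\<^sub>F K in sequentially. (\<Sum>i<K. w i) > 1/2 - \<epsilon> / 2"
    using assms by (intro order_tendstoD) auto
  then obtain K0 where K0: "\<And>K. K \<ge> K0 \<Longrightarrow> (\<Sum>i<K. w i) > 1/2 - \<epsilon> / 2"
    by (auto simp: eventually_at_top_linorder)
  show ?thesis
  proof (intro exI[of _ K0] allI impI)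
    fix K assume "K \<ge> K0"
    have "(\<lambda>n. \<Sum>i<K. w i * (w (n - i) / w n)) \<longlonglongrightarrow> (\<Sum>i<K. w i * 1)"
      by (intro tendsto_sum tendsto_mult tendsto_const w_ratio)
    then have "\<forall>\<^sub>F n in sequentially. (\<Sum>i<K. w i * (w (n - i) / w n)) > 1/2 - \<epsilon> / 2"
      using K0[OF \<open>K \<ge> K0\<close>] by (intro order_tendstoD) auto
    then show "\<forall>\<^sub>F n in sequentially. (\<Sum>i\<in>{K..n-K}. w i * w (n - i)) \<le> \<epsilon> * w n"
      using eventually_ge_at_top[of "2 * K + 2"]
    proof eventually_elim
      case (elim n)
      have "n \<ge> 2" using elim by simp
      have wn: "w n > 0" using elim by (intro w_pos) auto
      have s: "(\<Sum>i<K. w (n - i) * w (n - (n - i))) = (\<Sum>i<K. w i * w (n - i))"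
        using elim by (intro sum.cong) auto
      have "(\<Sum>i\<in>{K..n-K}. w i * w (n - i)) = w n - 2 * (\<Sum>i<K. w i * w (n - i))"
        using sum_split_ends[of K n "\<lambda>i. w i * w (n - i)"] elim w_conv[OF \<open>n \<ge> 2\<close>] s
        by simp
      also have "(\<Sum>i<K. w i * w (n - i)) = w n * (\<Sum>i<K. w i * (w (n - i) / w n))"
        using wn by (simp add: sum_distrib_left)
      also have "w n - 2 * \<dots> = w n * (1 - 2 * (\<Sum>i<K. w i * (w (n - i) / w n)))"
        by (simp add: algebra_simps)
      also have "\<dots> \<le> w n * \<epsilon>" using wn elim by (intro mult_left_mono) auto
      finally show ?case by (simp add: mult.commute)
    qed
  qed
qed

text \<open>In a convolution the numerator is taken at \<open>n - i\<close> but the denominator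
  stays at \<open>n\<close>. By \<open>w_ratio\<close> the mismatch costs arbitrarily little, as the
  ratio itself is at most \<open>\<bar>L\<bar> + E\<close> in absolute value.\<close>

lemma shifted_ratio:
  assumes "\<forall>\<^sub>F n in sequentially. \<bar>x n / w n - L\<bar> \<le> E" "\<epsilon> > 0"
  shows "\<forall>\<^sub>F n in sequentially. \<bar>x (n - i) / w n - L\<bar> \<le> E + \<epsilon>"
proof -
  have "(\<lambda>n. (\<bar>L\<bar> + E) * \<bar>w (n - i) / w n - 1\<bar>) \<longlonglongrightarrow> (\<bar>L\<bar> + E) * \<bar>1 - 1\<bar>"
    by (intro tendsto_intros w_ratio)
  then have "\<forall>\<^sub>F n in sequentially. (\<bar>L\<bar> + E) * \<bar>w (n - i) / w n - 1\<bar> < \<epsilon>"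
    using assms(2) by (intro order_tendstoD) auto
  moreover have "\<forall>\<^sub>F n in sequentially. \<bar>x (n - i) / w (n - i) - L\<bar> \<le> E"
    by (rule eventually_compose_filterlim[OF assms(1) filterlim_minus_const_nat_at_top])
  ultimately show ?thesis using eventually_gt_at_top[of i]
  proof eventually_elim
    case (elim n)
    have p: "w n > 0" "w (n - i) > 0" using elim by (auto intro: w_pos)
    let ?r = "x (n - i) / w (n - i)"
    have "x (n - i) / w n - ?r = ?r * (w (n - i) / w n - 1)"
      using p by (simp add: right_diff_distrib)
    then have "\<bar>x (n - i) / w n - ?r\<bar> = \<bar>?r\<bar> * \<bar>w (n - i) / w n - 1\<bar>"
      by (simp add: abs_mult)
    also have "\<dots> \<le> (\<bar>L\<bar> + E) * \<bar>w (n - i) / w n - 1\<bar>"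
    proof (rule mult_right_mono)
      show "\<bar>?r\<bar> \<le> \<bar>L\<bar> + E" using elim(2) by linarith
    qed simp
    finally show ?case using elim by linarith
  qed
qed

text \<open>The error \<open>e n = d n / w n - L\<close> satisfies, up to terms tending to \<open>0\<close>, the convolution equation
  \<open>e n = \<Sum>i. (b i - d i) e (n - i)\<close>, a contraction since \<open>\<Sum>b + \<Sum>d \<le> 1/2\<close>.\<close>

lemma ratio_limit_of_renewal:
  fixes b d :: "nat \<Rightarrow> real"
  assumes b: "\<And>n. 0 \<le> b n" and d: "\<And>n. 0 \<le> d n" and le: "\<And>n. b n + d n \<le> w n"
    and lim: "(\<lambda>n. (b n + d n) / w n) \<longlonglongrightarrow> q"
    and conv: "\<And>n. n \<ge> 2 \<Longrightarrow> d n = (\<Sum>i\<le>n. b i * d (n - i))"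
    and L: "L = suminf b * L + suminf d * (q - L)"
  shows "(\<lambda>n. d n / w n) \<longlonglongrightarrow> L"
proof -
  have bw: "b n \<le> w n" and dw: "d n \<le> w n" for n
    using le[of n] b[of n] d[of n] by linarith+
  have sb: "summable b" and sd: "summable d"
    using b d bw dw by (auto intro!: summable_comparison_test'[OF w_summable, where N = 0])
  have "suminf b + suminf d = (\<Sum>n. b n + d n)" by (rule suminf_add[OF sb sd])
  also have "\<dots> \<le> suminf w" by (intro suminf_le le summable_add sb sd w_summable)
  finally have half: "suminf b + suminf d \<le> 1/2" using sums_unique[OF w_sums] by simp
  define M where "M = \<bar>L\<bar> + \<bar>q - L\<bar>"
  have "(\<lambda>n. d n / w n - L) \<longlonglongrightarrow> 0"
  proof (rule tendsto_0_by_contraction)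
    show "\<forall>\<^sub>F n in sequentially. \<bar>d n / w n - L\<bar> \<le> 1 + \<bar>L\<bar>"
      using eventually_ge_at_top[of 1]
    proof eventually_elim
      case (elim n)
      have "0 \<le> d n / w n" "d n / w n \<le> 1" using w_pos[OF elim] d[of n] dw[of n] by auto
      then show ?case by linarith
    qed
    fix E :: real assume "E > 0" and E: "\<forall>\<^sub>F n in sequentially. \<bar>d n / w n - L\<bar> \<le> E"
    \<comment> \<open>Truncation, shifts and the middle sum together cost at most
      \<open>(M + 2) * \<eta>\<close>, chosen to be \<open>E / 4\<close>. With \<open>E / 2\<close>
      from the contraction this yields the factor 3/4.\<close>
    define \<eta> where "\<eta> = E / (4 * (M + 2))"
    have "M \<ge> 0" by (simp add: M_def)
    then have "\<eta> > 0" and \<eta>: "(M + 2) * \<eta> = E / 4"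
      using \<open>E > 0\<close> by (auto simp: \<eta>_def field_simps add_pos_pos)
    obtain K0 where K0: "\<And>K. K \<ge> K0 \<Longrightarrow>
        \<forall>\<^sub>F n in sequentially. (\<Sum>i\<in>{K..n-K}. w i * w (n - i)) \<le> \<eta> * w n"
      using w_middle[OF \<open>\<eta> > 0\<close>] by blast
    have "\<forall>\<^sub>F K in sequentially. (\<Sum>i<K. b i) > suminf b - \<eta>"
      using summable_LIMSEQ[OF sb] \<open>\<eta> > 0\<close> by (intro order_tendstoD) auto
    moreover have "\<forall>\<^sub>F K in sequentially. (\<Sum>i<K. d i) > suminf d - \<eta>"
      using summable_LIMSEQ[OF sd] \<open>\<eta> > 0\<close> by (intro order_tendstoD) auto
    ultimately have "\<forall>\<^sub>F K in sequentially. K \<ge> K0 \<and> (\<Sum>i<K. b i) > suminf b - \<eta> \<and>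
        (\<Sum>i<K. d i) > suminf d - \<eta>"
      using eventually_ge_at_top[of K0] by eventually_elim simp
    then obtain K where K: "K \<ge> K0" "(\<Sum>i<K. b i) > suminf b - \<eta>" "(\<Sum>i<K. d i) > suminf d - \<eta>"
      by (auto simp: eventually_at_top_linorder)
    let ?B = "\<Sum>i<K. b i" and ?D = "\<Sum>i<K. d i"
    have BD: "?B \<le> suminf b" "?D \<le> suminf d"
      using b d by (auto intro!: sum_le_suminf sb sd)
    have BD0: "?B \<ge> 0" "?D \<ge> 0" using b d by (auto intro: sum_nonneg)
    have "\<forall>\<^sub>F n in sequentially. \<bar>(b n + d n) / w n - q\<bar> < \<eta>"
      using tendstoD[OF lim \<open>\<eta> > 0\<close>] by (simp add: dist_real_def)
    \<comment> \<open>Since the ratio of \<open>b + d\<close> converges to \<open>q\<close>, the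
      ratio of \<open>b\<close> has the opposite error to that of \<open>d\<close>, up to
      \<open>\<eta>\<close>.\<close>
    with E have Eb: "\<forall>\<^sub>F n in sequentially. \<bar>b n / w n - (q - L)\<bar> \<le> E + \<eta>"
    proof eventually_elim
      case (elim n)
      then show ?case by (simp add: add_divide_distrib)
    qed
    have "\<forall>\<^sub>F n in sequentially. \<forall>i\<in>{..<K}. \<bar>d (n - i) / w n - L\<bar> \<le> E + \<eta>"
      by (intro eventually_ball_finite ballI shifted_ratio[OF E \<open>\<eta> > 0\<close>]) auto
    moreover have "\<forall>\<^sub>F n in sequentially. \<forall>i\<in>{..<K}. \<bar>b (n - i) / w n - (q - L)\<bar> \<le> E + \<eta> + \<eta>"
      by (intro eventually_ball_finite ballI shifted_ratio[OF Eb \<open>\<eta> > 0\<close>]) auto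
    ultimately show "\<forall>\<^sub>F n in sequentially. \<bar>d n / w n - L\<bar> \<le> 3/4 * E"
      using K0[OF K(1)] eventually_ge_at_top[of "2 * K + 2"]
    proof eventually_elim
      case (elim n)
      have n: "n \<ge> 2" using elim by simp
      have wn: "w n > 0" using n by (intro w_pos) auto
      let ?mid = "(\<Sum>i\<in>{K..n-K}. b i * d (n - i)) / w n"
      have mid0: "?mid \<ge> 0" using b d wn by (intro divide_nonneg_pos sum_nonneg mult_nonneg_nonneg) auto
      have "(\<Sum>i\<in>{K..n-K}. b i * d (n - i)) \<le> (\<Sum>i\<in>{K..n-K}. w i * w (n - i))"
        by (intro sum_mono mult_mono bw dw b d w_nonneg)
      then have mid1: "?mid \<le> \<eta>" using elim wn by (simp add: field_simps)
      have "d n = (\<Sum>i<K. b i * d (n - i)) + (\<Sum>i<K. b (n - i) * d (n - (n - i)))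
          + (\<Sum>i\<in>{K..n-K}. b i * d (n - i))"
        unfolding conv[OF n] using elim by (intro sum_split_ends) auto
      also have "(\<Sum>i<K. b (n - i) * d (n - (n - i))) = (\<Sum>i<K. d i * b (n - i))"
        using elim by (intro sum.cong) auto
      finally have "d n / w n = (\<Sum>i<K. b i * (d (n - i) / w n)) + (\<Sum>i<K. d i * (b (n - i) / w n)) + ?mid"
        by (simp add: add_divide_distrib sum_divide_distrib)
      also have "(\<Sum>i<K. b i * (d (n - i) / w n)) = (\<Sum>i<K. b i * (d (n - i) / w n - L)) + ?B * L"
        by (simp add: right_diff_distrib sum_subtractf sum_distrib_right)
      also have "(\<Sum>i<K. d i * (b (n - i) / w n)) = (\<Sum>i<K. d i * (b (n - i) / w n - (q - L))) + ?D * (q - L)"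
        by (simp add: right_diff_distrib sum_subtractf sum_distrib_right sum.distrib)
      \<comment> \<open>The equation assumed for \<open>L\<close> cancels the main terms; only the
        truncated tails \<open>suminf b - ?B\<close> and \<open>suminf d - ?D\<close> survive from
        them.\<close>
      finally have eq: "d n / w n - L = (\<Sum>i<K. b i * (d (n - i) / w n - L))
          + (\<Sum>i<K. d i * (b (n - i) / w n - (q - L)))
          - (suminf b - ?B) * L - (suminf d - ?D) * (q - L) + ?mid"
        using L by (simp add: algebra_simps)
      have "\<bar>\<Sum>i<K. b i * (d (n - i) / w n - L)\<bar> \<le> (\<Sum>i<K. b i * (E + \<eta>))"
        using elim b by (intro order_trans[OF sum_abs] sum_mono) (auto simp: abs_mult intro!: mult_left_mono)
      also have "\<dots> = ?B * (E + \<eta>)" by (simp add: sum_distrib_right)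
      also have "\<dots> \<le> suminf b * (E + 2 * \<eta>)"
        using BD BD0 \<open>E > 0\<close> \<open>\<eta> > 0\<close> by (intro mult_mono) auto
      finally have 1: "\<bar>\<Sum>i<K. b i * (d (n - i) / w n - L)\<bar> \<le> suminf b * (E + 2 * \<eta>)" .
      have "\<bar>\<Sum>i<K. d i * (b (n - i) / w n - (q - L))\<bar> \<le> (\<Sum>i<K. d i * (E + \<eta> + \<eta>))"
        using elim d by (intro order_trans[OF sum_abs] sum_mono) (auto simp: abs_mult intro!: mult_left_mono)
      also have "\<dots> = ?D * (E + \<eta> + \<eta>)" by (simp add: sum_distrib_right)
      also have "\<dots> \<le> suminf d * (E + 2 * \<eta>)"
        using BD BD0 \<open>E > 0\<close> \<open>\<eta> > 0\<close> by (intro mult_mono) auto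
      finally have 2: "\<bar>\<Sum>i<K. d i * (b (n - i) / w n - (q - L))\<bar> \<le> suminf d * (E + 2 * \<eta>)" .
      have "(suminf b + suminf d) * (E + 2 * \<eta>) \<le> 1/2 * (E + 2 * \<eta>)"
        using half \<open>E > 0\<close> \<open>\<eta> > 0\<close> by (intro mult_right_mono) auto
      then have 12: "suminf b * (E + 2 * \<eta>) + suminf d * (E + 2 * \<eta>) \<le> E / 2 + \<eta>"
        by (simp add: algebra_simps)
      have 3: "\<bar>(suminf b - ?B) * L\<bar> \<le> \<eta> * \<bar>L\<bar>" "\<bar>(suminf d - ?D) * (q - L)\<bar> \<le> \<eta> * \<bar>q - L\<bar>"
        using K BD by (auto simp: abs_mult intro!: mult_right_mono)
      have "\<eta> * \<bar>L\<bar> + \<eta> * \<bar>q - L\<bar> = \<eta> * M" by (simp add: M_def algebra_simps)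
      with eq 1 2 12 3 mid0 mid1 have "\<bar>d n / w n - L\<bar> \<le> E / 2 + \<eta> + \<eta> * M + \<eta>" by linarith
      also have "\<dots> = E / 2 + (M + 2) * \<eta>" by (simp add: algebra_simps)
      finally show ?case by (simp add: \<eta>)
    qed
  qed auto
  then show ?thesis by (simp add: LIM_zero_iff)
qed

end

section \<open>The limiting proportions\<close>

text \<open>The coefficients are scaled to radius of convergence \<open>1\<close>; this makes \<open>tail_weight m 0\<close>
  independent of \<open>m\<close>. With this scaling \<open>gap m k\<close> is \<open>1 - H\<^sub>k(1 / (4 m))\<close>.\<close>

definition tail_weight :: "nat \<Rightarrow> nat \<Rightarrow> nat \<Rightarrow> real" where
  "tail_weight m k n = real (count_outputs m ((\<le>) k) n) / (4 * real m) ^ n"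

definition level_weight :: "nat \<Rightarrow> nat \<Rightarrow> nat \<Rightarrow> real" where
  "level_weight m k n = real (count_outputs m (\<lambda>v. v = k) n) / (4 * real m) ^ n"

definition gap :: "nat \<Rightarrow> nat \<Rightarrow> real" where
  "gap m k = 1 - suminf (tail_weight m k)"

lemma normalised_convolution:
  fixes r :: real
  shows "real (\<Sum>i\<le>n. a i * b (n - i)) / r ^ n = (\<Sum>i\<le>n. real (a i) / r ^ i * (real (b (n - i)) / r ^ (n - i)))"
  unfolding of_nat_sum sum_divide_distrib
  by (intro sum.cong) (auto simp flip: power_add)

text \<open>At rank 0 every output counts, so there are \<open>m^n C_(n-1)\<close> of them, and
  division by \<open>(4 m)^n\<close> removes \<open>m\<close>.\<close>

lemma tail_weight_catalan:
  assumes "m \<ge> 1"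
  shows "catalan_weights (tail_weight m 0)"
proof
  show "tail_weight m 0 0 = 0" by (simp add: tail_weight_def count_outputs_0)
  show "tail_weight m 0 (Suc 0) = 1 / 4"
    using assms count_outputs_1[of m "(\<le>) 0"] by (simp add: tail_weight_def)
  fix n :: nat assume "n \<ge> 2"
  then have "count_outputs m ((\<le>) 0) n = (\<Sum>i\<le>n. count_outputs m ((\<le>) 0) i * count_outputs m ((\<le>) 0) (n - i))"
    by (rule count_outputs_Imp) auto
  then show "tail_weight m 0 n = (\<Sum>i\<le>n. tail_weight m 0 i * tail_weight m 0 (n - i))"
    by (simp only: tail_weight_def normalised_convolution)
qed

lemma tail_weight_split: "tail_weight m k n = tail_weight m (Suc k) n + level_weight m k n"
proof -
  have "count_outputs m ((\<le>) k) n = count_outputs m ((\<le>) (Suc k)) n + count_outputs m (\<lambda>v. v = k) n"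
    by (intro count_outputs_disjoint) auto
  then show ?thesis by (simp add: tail_weight_def level_weight_def add_divide_distrib)
qed

lemma tail_weight_nonneg: "tail_weight m k n \<ge> 0"
  by (simp add: tail_weight_def)

lemma level_weight_nonneg: "level_weight m k n \<ge> 0"
  by (simp add: level_weight_def)

lemma tail_weight_le: "tail_weight m k n \<le> tail_weight m 0 n"
  unfolding tail_weight_def count_outputs_def
  by (intro divide_right_mono of_nat_mono card_mono) (auto simp: finite_valued_trees)

lemma level_weight_conv:
  assumes "Suc k < m" "n \<ge> 2"
  shows "level_weight m k n = (\<Sum>i\<le>n. tail_weight m (Suc k) i * level_weight m k (n - i))"
proof -
  have "count_outputs m (\<lambda>v. v = k) n = (\<Sum>i\<le>n. count_outputs m ((\<le>) (Suc k)) i * count_outputs m (\<lambda>v. v = k) (n - i))"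
    using assms by (intro count_outputs_Imp) (auto simp: godel_imp_def)
  then show ?thesis by (simp only: tail_weight_def level_weight_def normalised_convolution)
qed

lemma level_weight_1:
  assumes "k < m"
  shows "level_weight m k (Suc 0) = 1 / (4 * real m)"
proof -
  have "{i. i < m \<and> i = k} = {k}" using assms by auto
  then show ?thesis using count_outputs_1[of m "\<lambda>v. v = k"] by (simp add: level_weight_def)
qed

section \<open>Values at the singularity\<close>

lemma summable_tail_weight:
  assumes "m \<ge> 1"
  shows "summable (tail_weight m k)" "summable (level_weight m k)" "suminf (tail_weight m k) \<le> 1/2"
proof -
  interpret catalan_weights "tail_weight m 0" by (rule tail_weight_catalan[OF assms])
  have "level_weight m k n \<le> tail_weight m 0 n" for n
    unfolding tail_weight_def level_weight_def count_outputs_def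
    by (intro divide_right_mono of_nat_mono card_mono) (auto simp: finite_valued_trees)
  then show s: "summable (tail_weight m k)" "summable (level_weight m k)"
    using tail_weight_nonneg level_weight_nonneg tail_weight_le
    by (auto intro!: summable_comparison_test'[OF w_summable, where N = 0])
  have "suminf (tail_weight m k) \<le> suminf (tail_weight m 0)"
    by (intro suminf_le tail_weight_le s w_summable)
  then show "suminf (tail_weight m k) \<le> 1/2" using sums_unique[OF w_sums] by simp
qed

lemma gap_0: "m \<ge> 1 \<Longrightarrow> gap m 0 = 1/2"
  using sums_unique[OF catalan_weights.w_sums[OF tail_weight_catalan[of m]]]
  by (simp add: gap_def)

lemma gap_ge_half: "m \<ge> 1 \<Longrightarrow> gap m k \<ge> 1/2"
  using summable_tail_weight(3)[of m k] by (simp add: gap_def)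

text \<open>This is \<open>G_k = x / (1 - H_(k+1))\<close> at \<open>x = 1 / (4 m)\<close>: the
  summed convolution, plus the single-leaf term at \<open>n = 1\<close> that the convolution does
  not produce.\<close>

lemma suminf_level_weight:
  assumes "Suc k < m"
  shows "suminf (level_weight m k) = 1 / (4 * real m) / gap m (Suc k)"
proof -
  let ?b = "tail_weight m (Suc k)" and ?d = "level_weight m k"
  have m: "m \<ge> 1" using assms by simp
  note s = summable_tail_weight[OF m]
  have "(\<lambda>n. \<Sum>i\<le>n. ?b i * ?d (n - i)) sums (suminf ?b * suminf ?d)"
    using s tail_weight_nonneg level_weight_nonneg by (intro Cauchy_product_sums) auto
  then have "(\<lambda>n. (\<Sum>i\<le>n. ?b i * ?d (n - i)) + (if n = 1 then 1 / (4 * real m) else 0)) sums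
      (suminf ?b * suminf ?d + 1 / (4 * real m))"
    by (intro sums_add sums_single)
  moreover have "(\<Sum>i\<le>n. ?b i * ?d (n - i)) + (if n = 1 then 1 / (4 * real m) else 0) = ?d n" for n
  proof -
    have 0: "?b 0 = 0" "?d 0 = 0" by (simp_all add: tail_weight_def level_weight_def count_outputs_0)
    consider "n = 0" | "n = 1" | "n \<ge> 2" by linarith
    then show ?thesis
      using assms by cases (auto simp: 0 level_weight_1 level_weight_conv)
  qed
  ultimately have "?d sums (suminf ?b * suminf ?d + 1 / (4 * real m))" by simp
  then have "suminf ?d = suminf ?b * suminf ?d + 1 / (4 * real m)"
    by (rule sums_unique[symmetric])
  then have "suminf ?d * gap m (Suc k) = 1 / (4 * real m)"
    by (simp add: gap_def algebra_simps)
  moreover have "gap m (Suc k) > 0" using gap_ge_half[OF m, of "Suc k"] by simp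
  ultimately show ?thesis using m by (simp add: eq_divide_eq ac_simps)
qed

lemma gap_Suc:
  assumes "Suc k < m"
  shows "gap m k = gap m (Suc k) - 1 / (4 * real m) / gap m (Suc k)"
proof -
  have m: "m \<ge> 1" using assms by simp
  have "suminf (tail_weight m k) = suminf (tail_weight m (Suc k)) + suminf (level_weight m k)"
    using suminf_add[OF summable_tail_weight(1,2)[OF m], of "Suc k" k]
    by (simp flip: tail_weight_split)
  then show ?thesis using suminf_level_weight[OF assms] by (simp add: gap_def)
qed

text \<open>\<open>1 + slope m k\<close> is the derivative of \<open>y - x / y\<close> at
  \<open>y = gap m k\<close>, for \<open>x = 1 / (4 m)\<close>. Heuristically, it is the factor by
  which the coefficient of the square root singularity changes from rank \<open>k\<close> to rank
  \<open>k - 1\<close>.\<close>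

definition slope :: "nat \<Rightarrow> nat \<Rightarrow> real" where
  "slope m k = 1 / (4 * real m) / (gap m k)\<^sup>2"

fun tail_limit :: "nat \<Rightarrow> nat \<Rightarrow> real" where
  "tail_limit m 0 = 1"
| "tail_limit m (Suc k) = tail_limit m k / (1 + slope m (Suc k))"

declare tail_limit.simps(2) [simp del]

text \<open>The induction goes upwards: from the ratio of tail \<open>k\<close>,
  \<open>ratio_limit_of_renewal\<close> gives that of level \<open>k\<close>, and their difference
  is the ratio of tail \<open>k + 1\<close>.\<close>

lemma tail_ratio_tendsto:
  assumes "k < m"
  shows "(\<lambda>n. tail_weight m k n / tail_weight m 0 n) \<longlonglongrightarrow> tail_limit m k"
  using assms
proof (induction k)
  case 0
  interpret catalan_weights "tail_weight m 0" using 0 by (intro tail_weight_catalan) simp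
  have "\<forall>\<^sub>F n in sequentially. 1 = tail_weight m 0 n / tail_weight m 0 n"
    using eventually_ge_at_top[of 1] by eventually_elim (use w_pos in force)
  then show ?case by (simp add: Lim_transform_eventually[OF tendsto_const])
next
  case (Suc k)
  have m: "m \<ge> 1" using Suc.prems by simp
  interpret catalan_weights "tail_weight m 0" by (rule tail_weight_catalan[OF m])
  let ?b = "tail_weight m (Suc k)" and ?d = "level_weight m k" and ?w = "tail_weight m 0"
  define q y \<rho> where "q = tail_limit m k" "y = gap m (Suc k)" "\<rho> = 1 / (4 * real m)"
  \<comment> \<open>The solution of \<open>L = (1 - y) * L + \<rho> / y * (q - L)\<close>.\<close>
  define L where "L = q * (\<rho> / (y\<^sup>2 + \<rho>))"
  have y: "y > 0" using gap_ge_half[OF m, of "Suc k"] by (simp add: q_y_\<rho>_def)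
  have \<rho>: "\<rho> > 0" using m by (simp add: q_y_\<rho>_def)
  have yr: "y\<^sup>2 + \<rho> > 0" using y \<rho> by (intro add_pos_pos) auto
  have split: "?b n + ?d n = tail_weight m k n" for n
    by (rule tail_weight_split[symmetric])
  have IH: "(\<lambda>n. (?b n + ?d n) / ?w n) \<longlonglongrightarrow> q"
    unfolding split q_y_\<rho>_def using Suc by simp
  have "(\<lambda>n. ?d n / ?w n) \<longlonglongrightarrow> L"
  proof (rule ratio_limit_of_renewal[OF tail_weight_nonneg level_weight_nonneg _ IH])
    show "?b n + ?d n \<le> ?w n" for n unfolding split by (rule tail_weight_le)
    show "?d n = (\<Sum>i\<le>n. ?b i * ?d (n - i))" if "n \<ge> 2" for n
      using level_weight_conv[OF Suc.prems that] .
    have "suminf ?d = \<rho> / y" "suminf ?b = 1 - y"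
      using suminf_level_weight[OF Suc.prems] by (simp_all add: q_y_\<rho>_def gap_def)
    moreover have "L = (1 - y) * L + \<rho> / y * (q - L)"
    proof -
      have "L * (y\<^sup>2 + \<rho>) = \<rho> * q" using yr by (simp add: L_def)
      then have "L * y * y = \<rho> * (q - L)" by (simp add: algebra_simps power2_eq_square)
      then have "L * y = \<rho> / y * (q - L)" using y by (simp add: eq_divide_eq)
      then show ?thesis by (simp add: algebra_simps)
    qed
    ultimately show "L = suminf ?b * L + suminf ?d * (q - L)" by simp
  qed
  from tendsto_diff[OF IH this] have "(\<lambda>n. ?b n / ?w n) \<longlonglongrightarrow> q - L"
    by (simp add: diff_divide_distrib[symmetric])
  also have "q - L = tail_limit m (Suc k)"
  proof -
    have "tail_limit m (Suc k) = q / (1 + \<rho> / y\<^sup>2)" by (simp only: tail_limit.simps slope_def q_y_\<rho>_def)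
    also have "1 + \<rho> / y\<^sup>2 = (y\<^sup>2 + \<rho>) / y\<^sup>2" using y by (simp add: add_divide_distrib)
    finally show ?thesis using yr by (simp add: L_def field_simps)
  qed
  finally show ?case .
qed

section \<open>Dependence on the rank\<close>

lemma q_limit:
  assumes "k < m"
  shows "(\<lambda>n. fps_nth (H_tail m k) n / fps_nth (G_total m) n) \<longlonglongrightarrow> tail_limit m k"
    "q_lim k m = tail_limit m k"
proof -
  have "fps_nth (H_tail m k) n / fps_nth (G_total m) n = tail_weight m k n / tail_weight m 0 n" for n
    using assms by (simp add: nth_H_tail nth_G_total tail_weight_def)
  then show "(\<lambda>n. fps_nth (H_tail m k) n / fps_nth (G_total m) n) \<longlonglongrightarrow> tail_limit m k"
    using tail_ratio_tendsto[OF assms] by simp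
  then show "q_lim k m = tail_limit m k" unfolding q_lim_def by (rule limI)
qed

lemma g_total_eq_sum_levels: "real (g_total m n) = fps_nth (G_total m) n"
  by (simp add: g_total_eq nth_G_total)

lemma card_outputs_ratio:
  "real (card {(\<phi>, \<nu>) \<in> outputs m n. eval m \<nu> \<phi> \<ge> k}) / real (card (outputs m n))
    = fps_nth (H_tail m k) n / fps_nth (G_total m) n"
  using card_outputs_eq[of m n "(\<le>) k"] card_outputs_eq[of m n "(\<le>) 0"]
  by (simp add: nth_H_tail nth_G_total)

lemma real_g_level:
  "k < m \<Longrightarrow> real (g_level m k n) = fps_nth (H_tail m k) n - fps_nth (H_tail m (Suc k)) n"
  by (simp add: nth_H_tail sum.atLeast_Suc_lessThan flip: sum_g_level)

lemma p_limit:
  assumes "j < m"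
  defines "p \<equiv> if Suc j < m then tail_limit m j - tail_limit m (Suc j) else tail_limit m j"
  shows "(\<lambda>n. real (g_level m j n) / real (g_total m n)) \<longlonglongrightarrow> p" "p_lim j m = p"
proof -
  show "(\<lambda>n. real (g_level m j n) / real (g_total m n)) \<longlonglongrightarrow> p"
  proof (cases "Suc j < m")
    case True
    then show ?thesis
      using tendsto_diff[OF q_limit(1)[OF assms(1)] q_limit(1)[OF True]] assms(1)
      by (simp add: p_def real_g_level g_total_eq_sum_levels diff_divide_distrib)
  next
    case False
    then have "H_tail m (Suc j) = 0" by (simp add: H_tail_def)
    then show ?thesis
      using q_limit(1)[OF assms(1)] assms(1) False
      by (simp add: p_def real_g_level g_total_eq_sum_levels)
  qed
  then show "p_lim j m = p" unfolding p_lim_def by (rule limI)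
qed

section \<open>Estimates for the gaps and the limiting proportions\<close>

lemma gap_pos: "m \<ge> 1 \<Longrightarrow> gap m k > 0"
  using gap_ge_half[of m k] by simp

text \<open>The upper bound rests on the gap being at least 1/2. Squares of slopes are thus at most
  \<open>1 / m^2\<close>, and over fewer than \<open>m\<close> steps they add up to
  \<open>O(1/m)\<close>.\<close>

lemma slope_bounds:
  assumes "m \<ge> 1"
  shows "0 < slope m k" "slope m k \<le> 1 / real m"
proof -
  have "(1/2)\<^sup>2 \<le> (gap m k)\<^sup>2" using gap_ge_half[OF assms] by (intro power_mono) auto
  then have "1 \<le> 4 * (gap m k)\<^sup>2" by (simp add: power2_eq_square)
  then have "1 / (4 * (gap m k)\<^sup>2) \<le> 1" by (subst divide_le_eq_1_pos) linarith+
  then have "1 / real m * (1 / (4 * (gap m k)\<^sup>2)) \<le> 1 / real m * 1"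
    by (intro mult_left_mono) auto
  then show "slope m k \<le> 1 / real m" by (simp add: slope_def ac_simps)
  show "0 < slope m k" using assms gap_pos[OF assms, of k] by (simp add: slope_def)
qed

lemma slope_gap_sq: "m \<ge> 1 \<Longrightarrow> slope m k * (gap m k)\<^sup>2 = 1 / (4 * real m)"
  using gap_pos[of m k] by (simp add: slope_def)

lemma tail_limit_slope:
  assumes "m \<ge> 1"
  shows "tail_limit m k = tail_limit m (Suc k) * (1 + slope m (Suc k))"
proof -
  have "tail_limit m (Suc k) = tail_limit m k / (1 + slope m (Suc k))" by (rule tail_limit.simps)
  moreover have "1 + slope m (Suc k) \<noteq> 0" using slope_bounds(1)[OF assms, of "Suc k"] by linarith
  ultimately show ?thesis by simp
qed

lemma gap_slope:
  assumes "Suc k < m"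
  shows "gap m k = gap m (Suc k) * (1 - slope m (Suc k))"
proof -
  have "gap m (Suc k) > 0" using assms by (intro gap_pos) simp
  then show ?thesis
    unfolding gap_Suc[OF assms] slope_def by (simp add: right_diff_distrib power2_eq_square)
qed

text \<open>Squaring \<open>gap_slope\<close> and using \<open>c * y^2 = 1 / (4 m)\<close> shows
  that the squared gap grows by \<open>1 / (2 m) - c / (4 m)\<close> per step, with \<open>c\<close>
  at most \<open>1 / m\<close>: an arithmetic progression up to \<open>1 / (4 m^2)\<close> per
  step.\<close>

lemma gap_sq_bounds:
  assumes "k < m"
  shows "(gap m k)\<^sup>2 \<le> 1/4 + real k / (2 * real m)"
    "(gap m k)\<^sup>2 \<ge> 1/4 + real k / (2 * real m) - real k / (4 * (real m)\<^sup>2)"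
proof -
  have "(gap m k)\<^sup>2 \<le> 1/4 + real k / (2 * real m) \<and>
      (gap m k)\<^sup>2 \<ge> 1/4 + real k / (2 * real m) - real k / (4 * (real m)\<^sup>2)"
    using assms
  proof (induction k)
    case 0
    then show ?case by (simp add: gap_0 power2_eq_square)
  next
    case (Suc k)
    have m: "m \<ge> 1" using Suc.prems by simp
    define y c where "y = gap m (Suc k)" "c = slope m (Suc k)"
    have c: "0 < c" "c \<le> 1 / real m" using slope_bounds[OF m] by (simp_all add: y_c_def)
    have cy: "c * y\<^sup>2 = 1 / (4 * real m)" using slope_gap_sq[OF m] by (simp add: y_c_def)
    have "(gap m k)\<^sup>2 = (y * (1 - c))\<^sup>2"
      by (simp only: gap_slope[OF Suc.prems] y_c_def)
    also have "\<dots> = y\<^sup>2 - 2 * (c * y\<^sup>2) + c * (c * y\<^sup>2)"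
      by (simp add: power2_eq_square algebra_simps)
    finally have eq: "y\<^sup>2 = (gap m k)\<^sup>2 + 1 / (2 * real m) - c * (1 / (4 * real m))"
      unfolding cy by simp
    have "c * (1 / (4 * real m)) \<le> 1 / real m * (1 / (4 * real m))"
      by (rule mult_right_mono[OF c(2)]) simp
    also have "\<dots> = 1 / (4 * (real m)\<^sup>2)" by (simp add: power2_eq_square)
    finally have le: "c * (1 / (4 * real m)) \<le> 1 / (4 * (real m)\<^sup>2)" .
    have ge: "0 \<le> c * (1 / (4 * real m))" using c by simp
    have Suc_div: "real (Suc k) / r = real k / r + 1 / r" for r by (simp add: add_divide_distrib)
    have IH: "(gap m k)\<^sup>2 \<le> 1/4 + real k / (2 * real m)"
      "(gap m k)\<^sup>2 \<ge> 1/4 + real k / (2 * real m) - real k / (4 * (real m)\<^sup>2)"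
      using Suc by auto
    show ?case
      unfolding y_c_def(1)[symmetric] eq Suc_div using le ge IH by linarith
  qed
  then show "(gap m k)\<^sup>2 \<le> 1/4 + real k / (2 * real m)"
    "(gap m k)\<^sup>2 \<ge> 1/4 + real k / (2 * real m) - real k / (4 * (real m)\<^sup>2)" by auto
qed

lemma tail_limit_pos:
  assumes "m \<ge> 1"
  shows "tail_limit m k > 0"
proof (induction k)
  case (Suc k)
  have "1 + slope m (Suc k) > 0" using slope_bounds(1)[OF assms, of "Suc k"] by linarith
  then show ?case using Suc unfolding tail_limit_slope[OF assms, of k] by (simp add: zero_less_mult_iff)
qed simp

text \<open>The difference is \<open>tail_limit m (Suc k) * slope m (Suc k)\<close>, whose first
  factor is at most 1. The bound is uniform in \<open>k\<close>.\<close>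

lemma tail_limit_diff_bounds:
  assumes "m \<ge> 1"
  shows "0 \<le> tail_limit m k - tail_limit m (Suc k)"
    "tail_limit m k - tail_limit m (Suc k) \<le> 1 / real m"
proof -
  have eq: "tail_limit m j - tail_limit m (Suc j) = tail_limit m (Suc j) * slope m (Suc j)" for j
    unfolding tail_limit_slope[OF assms, of j] by (simp add: algebra_simps)
  have dec: "tail_limit m (Suc j) \<le> tail_limit m j" for j
    using eq[of j] tail_limit_pos[OF assms, of "Suc j"] slope_bounds(1)[OF assms, of "Suc j"]
      mult_pos_pos[of "tail_limit m (Suc j)" "slope m (Suc j)"] by linarith
  then show "0 \<le> tail_limit m k - tail_limit m (Suc k)" by simp
  have "tail_limit m (Suc k) \<le> tail_limit m 0"
    by (rule lift_Suc_antimono_le[of "tail_limit m"]) (use dec in auto)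
  then have "tail_limit m (Suc k) * slope m (Suc k) \<le> 1 * (1 / real m)"
    using slope_bounds[OF assms, of "Suc k"] by (intro mult_mono) auto
  then show "tail_limit m k - tail_limit m (Suc k) \<le> 1 / real m" unfolding eq by simp
qed

text \<open>With \<open>c = slope m (k + 1) \<le> 1 / m\<close>, the step from \<open>k\<close> to \<open>k + 1\<close> multiplies the limiting
  proportion by \<open>1 / (1 + c)\<close> and the gap by \<open>1 / (1 - c)\<close>, so their product is almost invariant.\<close>

lemma tail_limit_gap_bounds:
  assumes "k < m" "m \<ge> 2"
  shows "1/2 \<le> tail_limit m k * gap m k"
    "tail_limit m k * gap m k * (1 - 1 / (real m)\<^sup>2) ^ k \<le> 1/2"
proof -
  have "1/2 \<le> tail_limit m k * gap m k \<and>
    tail_limit m k * gap m k * (1 - 1 / (real m)\<^sup>2) ^ k \<le> 1/2"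
    using assms(1)
  proof (induction k)
    case 0
    then show ?case by (simp add: gap_0)
  next
    case (Suc k)
    have m: "m \<ge> 1" using Suc.prems by simp
    define y c q where "y = gap m (Suc k)" "c = slope m (Suc k)" "q = tail_limit m (Suc k)"
    have y: "y > 0" using gap_pos[OF m] by (simp add: y_c_q_def)
    have c: "0 < c" "c \<le> 1 / real m" using slope_bounds[OF m] by (simp_all add: y_c_q_def)
    have q: "q > 0" unfolding y_c_q_def by (rule tail_limit_pos[OF m])
    have "tail_limit m k * gap m k = q * (1 + c) * (y * (1 - c))"
      by (simp only: tail_limit_slope[OF m, of k] gap_slope[OF Suc.prems] y_c_q_def)
    then have eq: "tail_limit m k * gap m k = q * y * (1 - c\<^sup>2)"
      by (simp add: algebra_simps power2_eq_square)
    have "c\<^sup>2 \<le> (1 / real m)\<^sup>2" using c by (intro power_mono) auto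
    then have c2: "1 - c\<^sup>2 \<ge> 1 - 1 / (real m)\<^sup>2" by (simp add: power_divide)
    have m0: "1 - 1 / (real m)\<^sup>2 \<ge> 0" using m by (simp add: divide_le_eq)
    have "1/2 \<le> q * y * (1 - c\<^sup>2)" using Suc eq by simp
    also have "\<dots> \<le> q * y * 1" using q y by (intro mult_left_mono) auto
    finally have 1: "1/2 \<le> q * y" by simp
    have "q * y * (1 - 1 / (real m)\<^sup>2) ^ Suc k = q * y * (1 - 1 / (real m)\<^sup>2) * (1 - 1 / (real m)\<^sup>2) ^ k"
      by simp
    also have "\<dots> \<le> q * y * (1 - c\<^sup>2) * (1 - 1 / (real m)\<^sup>2) ^ k"
      using q y c2 m0 by (intro mult_right_mono mult_left_mono) auto
    also have "\<dots> \<le> 1/2" using Suc eq by simp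
    finally show ?case using 1 unfolding y_c_q_def by simp
  qed
  then show "1/2 \<le> tail_limit m k * gap m k"
    "tail_limit m k * gap m k * (1 - 1 / (real m)\<^sup>2) ^ k \<le> 1/2" by auto
qed

text \<open>Bernoulli's inequality bounds \<open>(1 - 1 / m^2) ^ k\<close> below by
  \<open>1 - k / m^2\<close>, which is at least \<open>1 - 1 / m\<close>.\<close>

lemma tail_limit_gap_upper:
  assumes "k < m" "m \<ge> 2"
  shows "tail_limit m k * gap m k \<le> 1/2 * (real m / (real m - 1))"
proof -
  have m: "m \<ge> 1" "real m > 1" using assms by auto
  have "1 / (real m)\<^sup>2 \<le> 1" using m by (simp add: divide_le_eq)
  then have "1 + real k * (- (1 / (real m)\<^sup>2)) \<le> (1 + - (1 / (real m)\<^sup>2)) ^ k"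
    by (intro Bernoulli_inequality) simp
  moreover have "real k * (1 / (real m)\<^sup>2) \<le> real m * (1 / (real m)\<^sup>2)"
    using assms by (intro mult_right_mono) auto
  moreover have "real m * (1 / (real m)\<^sup>2) = 1 / real m" using m by (simp add: power2_eq_square)
  ultimately have "1 - (1 / real m) \<le> (1 - 1 / (real m)\<^sup>2) ^ k" by simp
  moreover have pos: "tail_limit m k * gap m k > 0"
    using tail_limit_pos[OF m(1)] gap_pos[OF m(1)] by simp
  ultimately have "tail_limit m k * gap m k * (1 - 1 / real m) \<le> 1/2"
    using tail_limit_gap_bounds(2)[OF assms] by (meson mult_left_mono less_imp_le order_trans)
  then show ?thesis using m by (simp add: field_simps)
qed

lemma rank_ratio:
  assumes "\<forall>m\<ge>2. k m < m"
  shows "(\<lambda>m. (gap m (k m))\<^sup>2 - (1/4 + real (k m) / (real m - 1) / 2)) \<longlonglongrightarrow> 0"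
    "(\<lambda>m. tail_limit m (k m) * gap m (k m)) \<longlonglongrightarrow> 1/2"
proof -
  have ev: "\<forall>\<^sub>F m in sequentially. m \<ge> 2" by (rule eventually_ge_at_top)
  show "(\<lambda>m. (gap m (k m))\<^sup>2 - (1/4 + real (k m) / (real m - 1) / 2)) \<longlonglongrightarrow> 0"
  proof (rule real_tendsto_sandwich)
    show "\<forall>\<^sub>F m in sequentially. - (1 / real m) \<le> (gap m (k m))\<^sup>2 - (1/4 + real (k m) / (real m - 1) / 2)"
      using ev
    proof eventually_elim
      case (elim m)
      have k: "k m < m" using assms elim by blast
      then have km: "real (k m) \<le> real m - 1" using elim by linarith
      have m: "real m > 1" using elim by simp
      have "real (k m) / (real m - 1) - real (k m) / real m = real (k m) / (real m - 1) * (1 / real m)"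
        using m by (simp add: field_simps)
      also have "\<dots> \<le> 1 * (1 / real m)" using km m by (intro mult_right_mono) auto
      finally have 1: "real (k m) / (real m - 1) - real (k m) / real m \<le> 1 / real m" by simp
      have "real (k m) / (4 * (real m)\<^sup>2) \<le> real m / (4 * (real m)\<^sup>2)"
        using k by (intro divide_right_mono) auto
      also have "\<dots> = 1 / (4 * real m)" using m by (simp add: power2_eq_square)
      also have "\<dots> \<le> 1 / real m / 2" using m by (simp add: field_simps)
      finally have 2: "real (k m) / (4 * (real m)\<^sup>2) \<le> 1 / real m / 2" .
      have "real (k m) / (2 * real m) = real (k m) / real m / 2" by simp
      \<comment> \<open>The claim is linear once the quotients are treated as variables. Passing
        from denominator \<open>m\<close> to \<open>m - 1\<close> and the error in
        \<open>gap_sq_bounds\<close> each cost at most \<open>1 / (2 m)\<close>.\<close>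
      moreover have "- i \<le> g - (1/4 + x / 2)"
        if "z = y / 2" "x - y \<le> i" "b \<le> i / 2" "g \<ge> 1/4 + z - b" for b g i x y z :: real
        using that by linarith
      ultimately show ?case using 1 2 gap_sq_bounds(2)[OF k] by blast
    qed
    show "\<forall>\<^sub>F m in sequentially. (gap m (k m))\<^sup>2 - (1/4 + real (k m) / (real m - 1) / 2) \<le> 0"
      using ev
    proof eventually_elim
      case (elim m)
      have k: "k m < m" using assms elim by blast
      have "real (k m) / (2 * real m) \<le> real (k m) / (2 * (real m - 1))"
        using elim by (intro divide_left_mono) auto
      then show ?case using gap_sq_bounds(1)[OF k] by (simp add: mult.commute)
    qed
    show "(\<lambda>m. - (1 / real m)) \<longlonglongrightarrow> 0" by real_asymp
  qed auto
  show "(\<lambda>m. tail_limit m (k m) * gap m (k m)) \<longlonglongrightarrow> 1/2"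
  proof (rule real_tendsto_sandwich[OF _ _ tendsto_const])
    show "\<forall>\<^sub>F m in sequentially. 1/2 \<le> tail_limit m (k m) * gap m (k m)"
      using ev by eventually_elim (use assms in \<open>blast intro: tail_limit_gap_bounds(1)\<close>)
    show "\<forall>\<^sub>F m in sequentially. tail_limit m (k m) * gap m (k m) \<le> 1/2 * (real m / (real m - 1))"
      using ev by eventually_elim (use assms in \<open>blast intro: tail_limit_gap_upper\<close>)
    show "(\<lambda>m. 1/2 * (real m / (real m - 1))) \<longlonglongrightarrow> 1/2" by real_asymp
  qed
qed

text \<open>The proportion is its product with the gap, tending to 1/2, divided by the gap, tending
  to \<open>sqrt (1/4 + t/2)\<close>.\<close>

lemma tail_limit_tendsto:
  assumes "\<forall>m\<ge>2. k m < m" and t: "(\<lambda>m. real (k m) / (real m - 1)) \<longlonglongrightarrow> t"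
  shows "(\<lambda>m. tail_limit m (k m)) \<longlonglongrightarrow> 1 / sqrt (1 + 2 * t)"
proof -
  have "\<forall>\<^sub>F m in sequentially. 0 \<le> real (k m) / (real m - 1)"
    using eventually_ge_at_top[of 1] by eventually_elim simp
  then have "t \<ge> 0" using t by (intro tendsto_lowerbound) auto
  have "(\<lambda>m. (gap m (k m))\<^sup>2 - (1/4 + real (k m) / (real m - 1) / 2) + (1/4 + real (k m) / (real m - 1) / 2))
      \<longlonglongrightarrow> 0 + (1/4 + t / 2)"
    by (intro tendsto_intros rank_ratio(1)[OF assms(1)] t) auto
  then have "(\<lambda>m. sqrt ((gap m (k m))\<^sup>2)) \<longlonglongrightarrow> sqrt (1/4 + t / 2)"
    by (intro tendsto_real_sqrt) simp
  moreover have "\<forall>\<^sub>F m in sequentially. sqrt ((gap m (k m))\<^sup>2) = gap m (k m)"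
    using eventually_ge_at_top[of 1] by eventually_elim (simp add: gap_pos less_imp_le)
  ultimately have "(\<lambda>m. gap m (k m)) \<longlonglongrightarrow> sqrt (1/4 + t / 2)"
    by (rule Lim_transform_eventually)
  then have "(\<lambda>m. tail_limit m (k m) * gap m (k m) / gap m (k m)) \<longlonglongrightarrow> 1/2 / sqrt (1/4 + t / 2)"
    using \<open>t \<ge> 0\<close> by (intro tendsto_divide rank_ratio(2)[OF assms(1)]) auto
  moreover have "\<forall>\<^sub>F m in sequentially. tail_limit m (k m) * gap m (k m) / gap m (k m) = tail_limit m (k m)"
    using eventually_ge_at_top[of 1]
    by eventually_elim (metis gap_pos less_irrefl nonzero_mult_div_cancel_right)
  ultimately have "(\<lambda>m. tail_limit m (k m)) \<longlonglongrightarrow> 1/2 / sqrt (1/4 + t / 2)"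
    by (rule Lim_transform_eventually)
  also have "1/4 + t / 2 = (1 + 2 * t) / 4" by simp
  also have "1/2 / sqrt ((1 + 2 * t) / 4) = 1 / sqrt (1 + 2 * t)" by (simp add: real_sqrt_divide)
  finally show ?thesis .
qed

text \<open>The limit formula is inverted through the gap: if the proportion tends to
  \<open>Q\<close>, the gap tends to \<open>1 / (2 Q)\<close>, and its square determines the rank
  ratio.\<close>

lemma rank_ratio_tendsto:
  assumes k: "\<forall>m\<ge>2. k m < m" and "L \<noteq> 0" and L: "(\<lambda>m. 1 - tail_limit m (k m)) \<longlonglongrightarrow> L"
  shows "\<exists>t. 0 < t \<and> t \<le> 1 \<and> (\<lambda>m. real (k m) / (real m - 1)) \<longlonglongrightarrow> t"
proof -
  have ev: "\<forall>\<^sub>F m in sequentially. m \<ge> 2" by (rule eventually_ge_at_top)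
  define Q where "Q = 1 - L"
  have Q: "(\<lambda>m. tail_limit m (k m)) \<longlonglongrightarrow> Q"
    using tendsto_diff[OF tendsto_const[of 1] L] by (simp add: Q_def)
  \<comment> \<open>Division by \<open>Q\<close> needs \<open>Q > 0\<close>; it comes from the
    product bound, since the gap is at most 1.\<close>
  have "\<forall>\<^sub>F m in sequentially. 1/2 \<le> tail_limit m (k m)"
    using ev
  proof eventually_elim
    case (elim m)
    then have *: "1/2 \<le> tail_limit m (k m) * gap m (k m)" using k by (blast intro: tail_limit_gap_bounds(1))
    have "suminf (tail_weight m (k m)) \<ge> 0"
      using elim by (intro suminf_nonneg summable_tail_weight tail_weight_nonneg) auto
    then have "gap m (k m) \<le> 1" by (simp add: gap_def)
    then have "tail_limit m (k m) * gap m (k m) \<le> tail_limit m (k m) * 1"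
      using elim by (intro mult_left_mono less_imp_le[OF tail_limit_pos]) auto
    with * show ?case by simp
  qed
  then have Q0: "Q > 0" using tendsto_lowerbound[OF Q, of "1/2"] by simp
  have "(\<lambda>m. tail_limit m (k m) * gap m (k m) / tail_limit m (k m)) \<longlonglongrightarrow> 1/2 / Q"
    using Q0 by (intro tendsto_divide rank_ratio(2)[OF k] Q) auto
  moreover have "\<forall>\<^sub>F m in sequentially. tail_limit m (k m) * gap m (k m) / tail_limit m (k m) = gap m (k m)"
    using ev
  proof eventually_elim
    case (elim m)
    then have "tail_limit m (k m) > 0" by (intro tail_limit_pos) auto
    then show ?case by simp
  qed
  ultimately have gap: "(\<lambda>m. gap m (k m)) \<longlonglongrightarrow> 1/2 / Q"
    by (rule Lim_transform_eventually)
  \<comment> \<open>Solves \<open>(1 / (2 Q))^2 = 1/4 + t/2\<close>; the \<open>0\<close> is the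
    limit of the error term in \<open>rank_ratio\<close>.\<close>
  define t where "t = 2 * ((1/2 / Q)\<^sup>2 - 0 - 1/4)"
  have "(\<lambda>m. 2 * ((gap m (k m))\<^sup>2 - ((gap m (k m))\<^sup>2 - (1/4 + real (k m) / (real m - 1) / 2)) - 1/4)) \<longlonglongrightarrow> t"
    unfolding t_def by (intro tendsto_intros gap rank_ratio(1)[OF k])
  moreover have "2 * (g - (g - (1/4 + x / 2)) - 1/4) = x" for g x :: real by simp
  ultimately have lim: "(\<lambda>m. real (k m) / (real m - 1)) \<longlonglongrightarrow> t" by (simp only:)
  have "\<forall>\<^sub>F m in sequentially. 0 \<le> real (k m) / (real m - 1)"
    using ev by eventually_elim simp
  then have "t \<ge> 0" using lim by (intro tendsto_lowerbound) auto
  have "\<forall>\<^sub>F m in sequentially. real (k m) / (real m - 1) \<le> 1"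
    using ev
  proof eventually_elim
    case (elim m)
    then have "k m < m" using k by blast
    then show ?case using elim by (simp add: divide_le_eq)
  qed
  then have "t \<le> 1" using lim by (intro tendsto_upperbound) auto
  have "t \<noteq> 0"
  proof
    assume "t = 0"
    then have "Q = 1" using LIMSEQ_unique[OF Q tail_limit_tendsto[OF k lim]] by simp
    then show False using \<open>L \<noteq> 0\<close> by (simp add: Q_def)
  qed
  then show ?thesis using \<open>t \<ge> 0\<close> \<open>t \<le> 1\<close> lim by (intro exI[of _ t]) auto
qed

lemma rank_bigtheta:
  assumes "(\<lambda>m. real (k m) / (real m - 1)) \<longlonglongrightarrow> t" "t \<noteq> 0"
  shows "(\<lambda>m. real (k m)) \<in> \<Theta>(\<lambda>m. real m)"
proof -
  have "(\<lambda>m. real (k m)) \<in> \<Theta>(\<lambda>m. real m - 1)"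
    using assms by (intro bigthetaI_tendsto) (auto intro: eventually_mono[OF eventually_gt_at_top[of 1]])
  also have "(\<lambda>m. real m - 1) \<in> \<Theta>(\<lambda>m. real m)" by real_asymp
  finally show ?thesis .
qed

text \<open>Smallness holds for all levels below the top at once, so it also applies to levels that
  move with \<open>m\<close>.\<close>

lemma p_lim_eventually_small:
  assumes "\<epsilon> > 0"
  shows "\<forall>\<^sub>F m in sequentially. \<forall>j. Suc j < m \<longrightarrow> \<bar>p_lim j m\<bar> < \<epsilon>"
proof -
  have "(\<lambda>m. 1 / real m) \<longlonglongrightarrow> 0" by real_asymp
  then have "\<forall>\<^sub>F m in sequentially. 1 / real m < \<epsilon>" using assms by (intro order_tendstoD) auto
  then show ?thesis using eventually_ge_at_top[of 1]
  proof eventually_elim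
    case (elim m)
    show ?case
    proof (intro allI impI)
      fix j assume "Suc j < m"
      then have "p_lim j m = tail_limit m j - tail_limit m (Suc j)" by (simp add: p_limit(2))
      then show "\<bar>p_lim j m\<bar> < \<epsilon>" using tail_limit_diff_bounds[of m j] elim by linarith
    qed
  qed
qed

text \<open>Levels below the top are uniformly negligible, so a nonzero limit forces
  \<open>k m = m - 1\<close> for all large \<open>m\<close>.\<close>

lemma rank_top_of_p_lim:
  assumes k: "\<forall>m\<ge>2. k m < m" and "L \<noteq> 0" and L: "(\<lambda>m. p_lim (k m) m) \<longlonglongrightarrow> L"
  shows "(\<lambda>m. real (k m) / (real m - 1)) \<longlonglongrightarrow> 1"
proof (rule Lim_transform_eventually[OF tendsto_const])
  have "\<forall>\<^sub>F m in sequentially. \<bar>p_lim (k m) m\<bar> > \<bar>L\<bar> / 2"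
    using tendsto_rabs[OF L] \<open>L \<noteq> 0\<close> by (intro order_tendstoD(1)) auto
  moreover have "\<forall>\<^sub>F m in sequentially. \<forall>j. Suc j < m \<longrightarrow> \<bar>p_lim j m\<bar> < \<bar>L\<bar> / 2"
    using \<open>L \<noteq> 0\<close> by (intro p_lim_eventually_small) auto
  ultimately show "\<forall>\<^sub>F m in sequentially. 1 = real (k m) / (real m - 1)"
    using eventually_ge_at_top[of 2]
  proof eventually_elim
    case (elim m)
    then have "\<not> Suc (k m) < m" by (meson less_asym)
    moreover have "k m < m" using k elim by blast
    ultimately have "m = Suc (k m)" by simp
    then have "real m - 1 = real (k m)" by linarith
    then show ?case using elim by simp
  qed
qed

section \<open>Rounded ranks and the theorem\<close>

lemma floor_rank_less:
  assumes "0 \<le> t" "t \<le> 1" "m \<ge> 2"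
  shows "nat \<lfloor>t * (real m - 1)\<rfloor> < m"
proof -
  have "t * (real m - 1) \<le> 1 * (real m - 1)" using assms by (intro mult_right_mono) auto
  then have "\<lfloor>t * (real m - 1)\<rfloor> < int m" by (simp add: floor_less_iff)
  then show ?thesis using assms by simp
qed

lemma floor_rank_ratio:
  assumes "0 \<le> t"
  shows "(\<lambda>m. real (nat \<lfloor>t * (real m - 1)\<rfloor>) / (real m - 1)) \<longlonglongrightarrow> t"
proof (rule real_tendsto_sandwich)
  have *: "m \<ge> 2 \<Longrightarrow> real (nat \<lfloor>t * (real m - 1)\<rfloor>) = of_int \<lfloor>t * (real m - 1)\<rfloor>" for m
    using assms by simp
  show "\<forall>\<^sub>F m in sequentially. t - 1 / (real m - 1) \<le> real (nat \<lfloor>t * (real m - 1)\<rfloor>) / (real m - 1)"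
    using eventually_ge_at_top[of 2]
  proof eventually_elim
    case (elim m)
    have "t * (real m - 1) - 1 \<le> of_int \<lfloor>t * (real m - 1)\<rfloor>" by linarith
    then have "(t * (real m - 1) - 1) / (real m - 1) \<le> real (nat \<lfloor>t * (real m - 1)\<rfloor>) / (real m - 1)"
      unfolding *[OF elim] using elim by (intro divide_right_mono) auto
    then show ?case using elim by (simp add: diff_divide_distrib)
  qed
  show "\<forall>\<^sub>F m in sequentially. real (nat \<lfloor>t * (real m - 1)\<rfloor>) / (real m - 1) \<le> t"
    using eventually_ge_at_top[of 2]
  proof eventually_elim
    case (elim m)
    show ?case unfolding *[OF elim] using elim by (simp add: divide_le_eq)
  qed
  show "(\<lambda>m. t - 1 / (real m - 1)) \<longlonglongrightarrow> t" by real_asymp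
qed simp

text \<open>The last conjunct makes precise that a nonzero limit needs a macroscopic rank. It covers
  the proportion at a moving level and the proportion \<open>1 - q\<close> below a moving cut;
  \<open>q\<close> itself would not do, as it stays at least 1/2 for every rank.\<close>

theorem theorem5:
  shows
    "(\<forall>m\<ge>2. \<forall>k<m.
        (\<lambda>n. fps_nth (H_tail m k) n / fps_nth (G_total m) n) \<longlonglongrightarrow> q_lim k m \<and>
        (\<lambda>n. real (card {(\<phi>, \<nu>) \<in> outputs m n. eval m \<nu> \<phi> \<ge> k}) / real (card (outputs m n)))
          \<longlonglongrightarrow> q_lim k m) \<and>
     (\<forall>m\<ge>2. \<forall>j<m. (\<lambda>n. real (g_level m j n) / real (g_total m n)) \<longlonglongrightarrow> p_lim j m) \<and>
     (\<forall>m\<ge>2. q_lim (m - 1) m = p_lim (m - 1) m) \<and>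
     (\<forall>m\<ge>2. \<forall>k\<le>m - 2. p_lim k m = q_lim k m - q_lim (k + 1) m) \<and>
     (\<forall>t::real. 0 \<le> t \<and> t \<le> 1 \<longrightarrow>
        (\<lambda>m. q_lim (nat \<lfloor>t * (real m - 1)\<rfloor>) m) \<longlonglongrightarrow> 1 / sqrt (1 + 2 * t)) \<and>
     (\<forall>j. (\<lambda>m. p_lim j m) \<longlonglongrightarrow> 0) \<and>
     (\<forall>(k::nat \<Rightarrow> nat) (t::real).
        (\<forall>m\<ge>2. k m < m) \<and> (\<lambda>m. real (k m) / (real m - 1)) \<longlonglongrightarrow> t \<longrightarrow>
        (\<lambda>m. q_lim (k m) m) \<longlonglongrightarrow> 1 / sqrt (1 + 2 * t)) \<and>
     (\<forall>(k::nat \<Rightarrow> nat) (L::real).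
        (\<forall>m\<ge>2. k m < m) \<and> L \<noteq> 0 \<and>
        ((\<lambda>m. p_lim (k m) m) \<longlonglongrightarrow> L \<or> (\<lambda>m. 1 - q_lim (k m) m) \<longlonglongrightarrow> L) \<longrightarrow>
        (\<lambda>m. real (k m)) \<in> \<Theta>(\<lambda>m. real m) \<and>
        (\<exists>t. 0 < t \<and> t \<le> 1 \<and> (\<lambda>m. real (k m) / (real m - 1)) \<longlonglongrightarrow> t))"
proof (intro conjI)
  have q_tendsto: "(\<lambda>m. q_lim (k m) m) \<longlonglongrightarrow> 1 / sqrt (1 + 2 * t)"
    if "\<forall>m\<ge>2. k m < m" "(\<lambda>m. real (k m) / (real m - 1)) \<longlonglongrightarrow> t" for k t
  proof (rule Lim_transform_eventually[OF tail_limit_tendsto[OF that]])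
    show "\<forall>\<^sub>F m in sequentially. tail_limit m (k m) = q_lim (k m) m"
      using eventually_ge_at_top[of 2] by eventually_elim (use that q_limit(2) in auto)
  qed
  show "\<forall>m\<ge>2. \<forall>k<m.
        (\<lambda>n. fps_nth (H_tail m k) n / fps_nth (G_total m) n) \<longlonglongrightarrow> q_lim k m \<and>
        (\<lambda>n. real (card {(\<phi>, \<nu>) \<in> outputs m n. eval m \<nu> \<phi> \<ge> k}) / real (card (outputs m n)))
          \<longlonglongrightarrow> q_lim k m"
    unfolding card_outputs_ratio using q_limit by auto
  show "\<forall>m\<ge>2. \<forall>j<m. (\<lambda>n. real (g_level m j n) / real (g_total m n)) \<longlonglongrightarrow> p_lim j m"
    using p_limit by auto
  show "\<forall>m\<ge>2. q_lim (m - 1) m = p_lim (m - 1) m"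
  proof (intro allI impI)
    fix m :: nat assume "m \<ge> 2"
    then show "q_lim (m - 1) m = p_lim (m - 1) m"
      using q_limit(2)[of "m - 1" m] p_limit(2)[of "m - 1" m] by simp
  qed
  show "\<forall>m\<ge>2. \<forall>k\<le>m - 2. p_lim k m = q_lim k m - q_lim (k + 1) m"
  proof (intro allI impI)
    fix m k :: nat assume "m \<ge> 2" "k \<le> m - 2"
    then have "k < m" "k + 1 < m" by auto
    then show "p_lim k m = q_lim k m - q_lim (k + 1) m"
      by (simp add: q_limit(2) p_limit(2))
  qed
  show "\<forall>t::real. 0 \<le> t \<and> t \<le> 1 \<longrightarrow>
        (\<lambda>m. q_lim (nat \<lfloor>t * (real m - 1)\<rfloor>) m) \<longlonglongrightarrow> 1 / sqrt (1 + 2 * t)"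
  proof (intro allI impI)
    fix t :: real assume "0 \<le> t \<and> t \<le> 1"
    then have "\<forall>m\<ge>2. nat \<lfloor>t * (real m - 1)\<rfloor> < m" and "0 \<le> t"
      using floor_rank_less by auto
    from q_tendsto[OF this(1) floor_rank_ratio[OF this(2)]]
    show "(\<lambda>m. q_lim (nat \<lfloor>t * (real m - 1)\<rfloor>) m) \<longlonglongrightarrow> 1 / sqrt (1 + 2 * t)" .
  qed
  show "\<forall>j. (\<lambda>m. p_lim j m) \<longlonglongrightarrow> 0"
  proof (intro allI tendstoI)
    fix j and \<epsilon> :: real assume "\<epsilon> > 0"
    show "\<forall>\<^sub>F m in sequentially. dist (p_lim j m) 0 < \<epsilon>"
      using p_lim_eventually_small[OF \<open>\<epsilon> > 0\<close>] eventually_gt_at_top[of "Suc j"]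
      by eventually_elim simp
  qed
  show "\<forall>(k::nat \<Rightarrow> nat) (t::real).
        (\<forall>m\<ge>2. k m < m) \<and> (\<lambda>m. real (k m) / (real m - 1)) \<longlonglongrightarrow> t \<longrightarrow>
        (\<lambda>m. q_lim (k m) m) \<longlonglongrightarrow> 1 / sqrt (1 + 2 * t)"
    using q_tendsto by blast
  show "\<forall>(k::nat \<Rightarrow> nat) (L::real).
        (\<forall>m\<ge>2. k m < m) \<and> L \<noteq> 0 \<and>
        ((\<lambda>m. p_lim (k m) m) \<longlonglongrightarrow> L \<or> (\<lambda>m. 1 - q_lim (k m) m) \<longlonglongrightarrow> L) \<longrightarrow>
        (\<lambda>m. real (k m)) \<in> \<Theta>(\<lambda>m. real m) \<and>
        (\<exists>t. 0 < t \<and> t \<le> 1 \<and> (\<lambda>m. real (k m) / (real m - 1)) \<longlonglongrightarrow> t)"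
  proof (intro allI impI)
    fix k :: "nat \<Rightarrow> nat" and L :: real
    assume asm: "(\<forall>m\<ge>2. k m < m) \<and> L \<noteq> 0 \<and>
        ((\<lambda>m. p_lim (k m) m) \<longlonglongrightarrow> L \<or> (\<lambda>m. 1 - q_lim (k m) m) \<longlonglongrightarrow> L)"
    then have k: "\<forall>m\<ge>2. k m < m" and "L \<noteq> 0" by auto
    have "\<exists>t. 0 < t \<and> t \<le> 1 \<and> (\<lambda>m. real (k m) / (real m - 1)) \<longlonglongrightarrow> t"
    proof (cases "(\<lambda>m. p_lim (k m) m) \<longlonglongrightarrow> L")
      case True
      show ?thesis using rank_top_of_p_lim[OF k \<open>L \<noteq> 0\<close> True] by (intro exI[of _ 1]) simp
    next
      case False
      then have "(\<lambda>m. 1 - q_lim (k m) m) \<longlonglongrightarrow> L" using asm by blast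
      moreover have "\<forall>\<^sub>F m in sequentially. 1 - q_lim (k m) m = 1 - tail_limit m (k m)"
        using eventually_ge_at_top[of 2] by eventually_elim (use k q_limit(2) in auto)
      ultimately have "(\<lambda>m. 1 - tail_limit m (k m)) \<longlonglongrightarrow> L" by (rule Lim_transform_eventually)
      then show ?thesis by (rule rank_ratio_tendsto[OF k \<open>L \<noteq> 0\<close>])
    qed
    then show "(\<lambda>m. real (k m)) \<in> \<Theta>(\<lambda>m. real m) \<and>
        (\<exists>t. 0 < t \<and> t \<le> 1 \<and> (\<lambda>m. real (k m) / (real m - 1)) \<longlonglongrightarrow> t)"
      using rank_bigtheta by blast
  qed
qed

end
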